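(* Let $\mathcal{G}$ be the set of all probability distributions on $(0,\infty)$. For $G\in\mathcal{G}$ and $\lambda>0$ let $1-\rho(G,\lambda)$ be the spectral gap of the Model 1 workload process with arrival rate $\lambda$ and service distribution $G$. Then $$\inf_{G\in\mathcal{G},\ \lambda>0}\bigl(1-\rho(G,\lambda)\bigr)=0.$$
   Context: Model 1 (M/G/1 workload with truncated service at capacity 1). Let $T_0=0$ and let the inter-arrival times $T_i-T_{i-1}$, $i\ge1$, be i.i.d. exponential with mean $1/\lambda$; let $(S_n)_{n\ge1}$ be i.i.d. with distribution $G$ on $(0,\infty)$, independent of $(T_n)$. For $x\in[0,1]$ define $V^{1,x}_0=x$, $$V^{1,x}_t=\max[V^{1,x}_{T_{n-1}}-(t-T_{n-1}),0]\quad (T_{n-1}\le t<T_n,\ n\ge1),\qquad V^{1,x}_{T_n}=\min[S_n+V^{1,x}_{T_n-},\,1]\quad(n\ge1),$$ where $V^{1,x}_{T_n-}$ is the left limit at $T_n$. This is a Markov process on $[0,1]$ with a unique invariant probability distribution $\pi$. Spectral gap: with $\|\mu-\nu\|_{TV}=\sup_{A\text{ Borel}}|\mu(A)-\nu(A)|$, put $d(t)=\sup_{x\in[0,1]}\|\mathbb{P}(V_t^{1,x}\in\cdot)-\pi\|_{TV}$ and $\rho(G,\lambda)=\limsup_{t\to\infty}d(t)^{1/t}$. The spectral gap is $1-\rho(G,\lambda)$. *)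

theory Defs
  imports "HOL-Probability.Probability"
begin

text \<open>
  A sample point is a pair of sequences \<open>(\<tau>, s)\<close>, indexed from 0: \<open>\<tau> n = T\<^bsub>n+1\<^esub> - T\<^bsub>n\<^esub>\<close> is the
  inter-arrival time preceding arrival \<open>n + 1\<close>, and \<open>s n = S\<^bsub>n+1\<^esub>\<close> is the service time brought
  by that arrival.
\<close>

definition arrival :: "(nat \<Rightarrow> real) \<Rightarrow> nat \<Rightarrow> real" where
  "arrival \<tau> n = (\<Sum>i<n. \<tau> i)"

text \<open>
  The value at the epoch \<open>T\<^bsub>n\<^esub>\<close>.  The term \<open>max (\<dots> - \<tau> n) 0\<close> is the left limit at \<open>T\<^bsub>n+1\<^esub>\<close>;
  see \<open>workload_left_limit\<close> below.
\<close>

primrec epoch_workload :: "real \<Rightarrow> (nat \<Rightarrow> real) \<Rightarrow> (nat \<Rightarrow> real) \<Rightarrow> nat \<Rightarrow> real" where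
  "epoch_workload x \<tau> s 0 = x"
| "epoch_workload x \<tau> s (Suc n) = min (s n + max (epoch_workload x \<tau> s n - \<tau> n) 0) 1"

text \<open>
  For positive inter-arrival times this is the unique \<open>n\<close> with \<open>T\<^bsub>n\<^esub> \<le> t < T\<^bsub>n+1\<^esub>\<close>, if there is
  one; there is none only on the null event that the arrival epochs stay below \<open>t\<close>.
\<close>

definition arrivals_by :: "(nat \<Rightarrow> real) \<Rightarrow> real \<Rightarrow> nat" where
  "arrivals_by \<tau> t = (LEAST n. t < arrival \<tau> (Suc n))"

definition workload :: "real \<Rightarrow> (nat \<Rightarrow> real) \<Rightarrow> (nat \<Rightarrow> real) \<Rightarrow> real \<Rightarrow> real" where
  "workload x \<tau> s t =
     (let n = arrivals_by \<tau> t in max (epoch_workload x \<tau> s n - (t - arrival \<tau> n)) 0)"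

text \<open>
  The following facts are the defining equations of the process, along every path with positive
  inter-arrival times and nonnegative service times.
\<close>

lemma arrivals_by_eq:
  assumes "\<And>i. 0 < \<tau> i" "arrival \<tau> n \<le> t" "t < arrival \<tau> (Suc n)"
  shows "arrivals_by \<tau> t = n"
  unfolding arrivals_by_def
proof (rule Least_equality)
  fix m assume m: "t < arrival \<tau> (Suc m)"
  show "n \<le> m"
  proof (rule ccontr)
    assume "\<not> n \<le> m"
    then have "arrival \<tau> (Suc m) \<le> arrival \<tau> n"
      unfolding arrival_def using assms(1) by (intro sum_mono2) (auto simp: less_imp_le)
    with m assms(2) show False by simp
  qed
qed (fact assms(3))

lemma workload_between:
  assumes "\<And>i. 0 < \<tau> i" "arrival \<tau> n \<le> t" "t < arrival \<tau> (Suc n)"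
  shows "workload x \<tau> s t = max (epoch_workload x \<tau> s n - (t - arrival \<tau> n)) 0"
  using arrivals_by_eq[OF assms] by (simp add: workload_def)

lemma arrival_less_Suc: "0 < \<tau> n \<Longrightarrow> arrival \<tau> n < arrival \<tau> (Suc n)"
  by (simp add: arrival_def)

lemma workload_at_epoch:
  assumes "\<And>i. 0 < \<tau> i"
  shows "workload x \<tau> s (arrival \<tau> n) = max (epoch_workload x \<tau> s n) 0"
  using workload_between[OF assms order_refl arrival_less_Suc[of \<tau> n]] assms by simp

lemma workload_zero:
  assumes "\<And>i. 0 < \<tau> i" "0 \<le> x"
  shows "workload x \<tau> s 0 = x"
  using workload_at_epoch[of \<tau> x s 0] assms by (simp add: arrival_def)

lemma workload_decreasing:
  assumes "\<And>i. 0 < \<tau> i" "arrival \<tau> n \<le> t" "t < arrival \<tau> (Suc n)"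
  shows "workload x \<tau> s t = max (workload x \<tau> s (arrival \<tau> n) - (t - arrival \<tau> n)) 0"
  using workload_between[OF assms] workload_at_epoch[OF assms(1)] assms(2) by simp

lemma workload_left_limit:
  assumes "\<And>i. 0 < \<tau> i"
  shows "(workload x \<tau> s \<longlongrightarrow> max (epoch_workload x \<tau> s n - \<tau> n) 0) (at_left (arrival \<tau> (Suc n)))"
proof -
  let ?f = "\<lambda>t. max (epoch_workload x \<tau> s n - (t - arrival \<tau> n)) 0"
  have "(?f \<longlongrightarrow> ?f (arrival \<tau> (Suc n))) (at_left (arrival \<tau> (Suc n)))"
    by (intro tendsto_intros)
  then have lim: "(?f \<longlongrightarrow> max (epoch_workload x \<tau> s n - \<tau> n) 0) (at_left (arrival \<tau> (Suc n)))"
    by (simp add: arrival_def)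
  have "\<forall>\<^sub>F t in at_left (arrival \<tau> (Suc n)). t \<in> {arrival \<tau> n <..< arrival \<tau> (Suc n)}"
    using arrival_less_Suc[OF assms] by (rule eventually_at_left_real)
  then have "\<forall>\<^sub>F t in at_left (arrival \<tau> (Suc n)). ?f t = workload x \<tau> s t"
    by eventually_elim (simp add: workload_between[where n = n, OF assms])
  with lim show ?thesis by (rule Lim_transform_eventually)
qed

lemma workload_jump:
  assumes "\<And>i. 0 < \<tau> i" "\<And>i. 0 \<le> s i"
    and "(workload x \<tau> s \<longlongrightarrow> l) (at_left (arrival \<tau> (Suc n)))"
  shows "workload x \<tau> s (arrival \<tau> (Suc n)) = min (s n + l) 1"
proof -
  have "l = max (epoch_workload x \<tau> s n - \<tau> n) 0"
    using assms(3) workload_left_limit[OF assms(1)] by (rule tendsto_unique[rotated]) simp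
  then show ?thesis
    using assms(2)[of n] by (simp add: workload_at_epoch[OF assms(1)] max_def min_def)
qed


text \<open>The probability distributions on \<open>(0, \<infinity>)\<close>, as Borel measures on the real line.\<close>

definition service_laws :: "real measure set" where
  "service_laws = {G. prob_space G \<and> sets G = sets borel \<and> emeasure G {0<..} = 1}"

definition input_space :: "real measure \<Rightarrow> real \<Rightarrow> ((nat \<Rightarrow> real) \<times> (nat \<Rightarrow> real)) measure" where
  "input_space G lam =
     (\<Pi>\<^sub>M i\<in>UNIV. density lborel (exponential_density lam)) \<Otimes>\<^sub>M (\<Pi>\<^sub>M i\<in>UNIV. G)"

definition workload_law :: "real measure \<Rightarrow> real \<Rightarrow> real \<Rightarrow> real \<Rightarrow> real measure" where
  "workload_law G lam x t = distr (input_space G lam) borel (\<lambda>(\<tau>, s). workload x \<tau> s t)"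

lemma prob_space_input_space:
  assumes "G \<in> service_laws" "0 < lam"
  shows "prob_space (input_space G lam)"
proof -
  interpret E: prob_space "density lborel (exponential_density lam)"
    using assms(2) by (rule prob_space_exponential_density)
  interpret G: prob_space G using assms(1) by (simp add: service_laws_def)
  interpret E': prob_space "\<Pi>\<^sub>M i\<in>(UNIV::nat set). density lborel (exponential_density lam)"
    by (intro prob_space_PiM E.prob_space_axioms)
  interpret G': prob_space "\<Pi>\<^sub>M i\<in>(UNIV::nat set). G"
    by (intro prob_space_PiM G.prob_space_axioms)
  interpret pair_prob_space "\<Pi>\<^sub>M i\<in>(UNIV::nat set). density lborel (exponential_density lam)"
    "\<Pi>\<^sub>M i\<in>(UNIV::nat set). G" ..
  show ?thesis unfolding input_space_def by (rule prob_space_axioms)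
qed

lemma measurable_workload:
  assumes "G \<in> service_laws"
  shows "(\<lambda>(x, \<tau>, s). workload x \<tau> s t) \<in> borel_measurable (borel \<Otimes>\<^sub>M input_space G lam)"
proof -
  let ?M = "borel \<Otimes>\<^sub>M input_space G lam :: (real \<times> (nat \<Rightarrow> real) \<times> (nat \<Rightarrow> real)) measure"
  have sG: "sets G = sets borel" using assms by (simp add: service_laws_def)
  have sets_in: "sets (input_space G lam) = sets ((\<Pi>\<^sub>M i\<in>UNIV. borel) \<Otimes>\<^sub>M (\<Pi>\<^sub>M i\<in>UNIV. borel))"
    unfolding input_space_def by (intro sets_pair_measure_cong sets_PiM_cong) (auto simp: sG)
  have M: "sets ?M = sets (borel \<Otimes>\<^sub>M ((\<Pi>\<^sub>M i\<in>UNIV. borel) \<Otimes>\<^sub>M (\<Pi>\<^sub>M i\<in>UNIV. borel)))"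
    by (intro sets_pair_measure_cong refl sets_in)
  have [measurable]: "(\<lambda>p. fst (snd p) i) \<in> borel_measurable ?M"
    "(\<lambda>p. snd (snd p) i) \<in> borel_measurable ?M" for i
    unfolding measurable_cong_sets[OF M refl] by measurable
  have [measurable]: "(\<lambda>p. arrival (fst (snd p)) n) \<in> borel_measurable ?M" for n
    unfolding arrival_def by measurable
  have [measurable]: "(\<lambda>p. epoch_workload (fst p) (fst (snd p)) (snd (snd p)) n) \<in> borel_measurable ?M" for n
    by (induction n) (simp_all, measurable)
  have N[measurable]: "(\<lambda>p. arrivals_by (fst (snd p)) t) \<in> measurable ?M (count_space UNIV)"
    unfolding arrivals_by_def by measurable
  have "(\<lambda>p. workload (fst p) (fst (snd p)) (snd (snd p)) t) \<in> borel_measurable ?M"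
    unfolding workload_def Let_def
    by (rule measurable_compose_countable[OF _ N]) measurable
  then show ?thesis by (simp add: case_prod_beta')
qed


definition is_invariant :: "real measure \<Rightarrow> real \<Rightarrow> real measure \<Rightarrow> bool" where
  "is_invariant G lam \<pi> \<longleftrightarrow>
     prob_space \<pi> \<and> sets \<pi> = sets borel \<and> emeasure \<pi> {0..1} = 1 \<and>
     (\<forall>t\<ge>0. \<forall>A\<in>sets borel. (\<integral>\<^sup>+x. emeasure (workload_law G lam x t) A \<partial>\<pi>) = emeasure \<pi> A)"

definition invariant_law :: "real measure \<Rightarrow> real \<Rightarrow> real measure" where
  "invariant_law G lam = (THE \<pi>. is_invariant G lam \<pi>)"

definition tv_dist :: "real measure \<Rightarrow> real measure \<Rightarrow> real" where
  "tv_dist \<mu> \<nu> = (SUP A\<in>sets borel. \<bar>measure \<mu> A - measure \<nu> A\<bar>)"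

definition mixing_dist :: "real measure \<Rightarrow> real \<Rightarrow> real \<Rightarrow> real" where
  "mixing_dist G lam t = (SUP x\<in>{0..1}. tv_dist (workload_law G lam x t) (invariant_law G lam))"

text \<open>The limit superior and the infimum below are taken in the complete lattice of extended reals.\<close>

definition conv_rate :: "real measure \<Rightarrow> real \<Rightarrow> ereal" where
  "conv_rate G lam = Limsup at_top (\<lambda>t::real. ereal (mixing_dist G lam t powr (1 / t)))"

definition spectral_gap :: "real measure \<Rightarrow> real \<Rightarrow> ereal" where
  "spectral_gap G lam = 1 - conv_rate G lam"

end

theory Submission
  imports Defs
begin

text \<open>
  Decomposing at the first arrival gives a renewal equation for \<open>E f(V\<^sub>t)\<close>.  Its bounded solution
  is unique, which yields the semigroup property; since all paths meet at 0 after an idle gap longer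
  than 1, an invariant law exists and is unique, and \<open>d(t) \<le> 1\<close> makes every gap nonnegative.

  For the upper bound take exponential services of rate \<open>\<mu>\<close> and arrival rate
  \<open>\<lambda> = \<mu> + 4\<pi>\<^sup>2/\<mu>\<close>.  Two copies started at \<open>x\<close> and \<open>x + 1/2\<close> and driven by the same input stay at
  distance \<open>1/2\<close> as long as the lower one moves inside \<open>[0, 1/2]\<close> without touching the boundary.
  The function \<open>exp (- 4\<pi>\<^sup>2 t/\<mu>) sin (2\<pi>x)\<close> is a subsolution of the renewal equation for the
  probability of being on different sides of \<open>1/2\<close> at time \<open>t\<close>, so this probability decays no faster,
  and neither does \<open>d(t)\<close>.  Hence the gap is at most \<open>4\<pi>\<^sup>2/\<mu>\<close>, which tends to 0.
\<close>

section \<open>Paths of the workload process\<close>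

lemma measurable_arrival [measurable (raw)]:
  assumes [measurable]: "h \<in> measurable M (\<Pi>\<^sub>M i\<in>UNIV. borel)"
  shows "(\<lambda>w. arrival (h w) n) \<in> borel_measurable M"
  unfolding arrival_def by measurable

lemma measurable_epoch_workload [measurable (raw)]:
  assumes [measurable]: "f \<in> borel_measurable M" "h \<in> measurable M (\<Pi>\<^sub>M i\<in>UNIV. borel)"
    "k \<in> measurable M (\<Pi>\<^sub>M i\<in>UNIV. borel)"
  shows "(\<lambda>w. epoch_workload (f w) (h w) (k w) n) \<in> borel_measurable M"
  by (induction n) (simp_all, measurable)

text \<open>In contrast to \<open>measurable_workload\<close>, the time may depend on the point as
  well: in the renewal equation the remaining time \<open>t - a\<close> is integrated over
  \<open>a\<close>.\<close>

lemma measurable_workload_compose [measurable (raw)]: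
  assumes [measurable]: "f \<in> borel_measurable M" "h \<in> measurable M (\<Pi>\<^sub>M i\<in>UNIV. borel)"
    "k \<in> measurable M (\<Pi>\<^sub>M i\<in>UNIV. borel)" "g \<in> borel_measurable M"
  shows "(\<lambda>w. workload (f w) (h w) (k w) (g w)) \<in> borel_measurable M"
proof -
  have N: "(\<lambda>w. arrivals_by (h w) (g w)) \<in> measurable M (count_space UNIV)"
    unfolding arrivals_by_def by measurable
  show ?thesis
    unfolding workload_def Let_def
    by (rule measurable_compose_countable[OF _ N]) measurable
qed

lemma arrival_case_nat: "arrival (case_nat a \<tau>) (Suc n) = a + arrival \<tau> n"
  unfolding arrival_def by (subst sum.lessThan_Suc_shift) simp

lemma epoch_workload_case_nat:
  "epoch_workload x (case_nat a \<tau>) (case_nat b s) (Suc n) =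
    epoch_workload (min (b + max (x - a) 0) 1) \<tau> s n"
  by (induction n) auto

lemma workload_before_first_arrival:
  assumes "t < \<tau> 0"
  shows "workload x \<tau> s t = max (x - t) 0"
proof -
  have "arrivals_by \<tau> t = 0"
    unfolding arrivals_by_def using assms by (intro Least_eq_0) (simp add: arrival_def)
  then show ?thesis by (simp add: workload_def arrival_def)
qed

text \<open>Regeneration at the first arrival: dropping the first gap and the first service shifts
  the index in \<open>arrivals_by\<close> by one. Some epoch has to exceed the remaining time, since
  otherwise the \<open>LEAST\<close> is unspecified.\<close>

lemma workload_after_first_arrival:
  assumes "a \<le> t" "\<exists>n. t - a < arrival \<tau> n"
  shows "workload x (case_nat a \<tau>) (case_nat b s) t =
    workload (min (b + max (x - a) 0) 1) \<tau> s (t - a)"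
proof -
  obtain n where n: "t - a < arrival \<tau> n" using assms by auto
  have P: "t < arrival (case_nat a \<tau>) (Suc n)" using n by (simp add: arrival_case_nat)
  have "arrivals_by (case_nat a \<tau>) t = Suc (LEAST n. t < arrival (case_nat a \<tau>) (Suc (Suc n)))"
    unfolding arrivals_by_def
    by (rule Least_Suc[where P="\<lambda>n. t < arrival (case_nat a \<tau>) (Suc n)", OF P]) (use assms in \<open>simp add: arrival_def\<close>)
  also have "(LEAST n. t < arrival (case_nat a \<tau>) (Suc (Suc n))) = arrivals_by \<tau> (t - a)"
    unfolding arrivals_by_def arrival_case_nat by (simp add: algebra_simps)
  finally show ?thesis
    by (simp add: workload_def arrival_case_nat epoch_workload_case_nat algebra_simps Let_def
      del: epoch_workload.simps)
qed

lemma epoch_workload_le_1: "x \<le> 1 \<Longrightarrow> epoch_workload x \<tau> s n \<le> 1"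
  by (cases n) auto

lemma workload_nonneg: "0 \<le> workload x \<tau> s t"
  by (simp add: workload_def Let_def)

lemma workload_le_1:
  assumes "x \<le> 1" "0 \<le> t" "\<exists>n. t < arrival \<tau> n"
  shows "workload x \<tau> s t \<le> 1"
proof -
  \<comment> \<open>Minimality in \<open>LEAST\<close> excludes the predecessor index. Hence the
    workload has only decreased since an epoch at which it was at most 1.\<close>
  have "arrival \<tau> (arrivals_by \<tau> t) \<le> t"
  proof (cases "arrivals_by \<tau> t")
    case 0
    with assms show ?thesis by (simp add: arrival_def)
  next
    case (Suc m)
    then show ?thesis using not_less_Least[of m "\<lambda>n. t < arrival \<tau> (Suc n)"]
      by (auto simp: arrivals_by_def)
  qed
  with epoch_workload_le_1[OF assms(1), of \<tau> s "arrivals_by \<tau> t"] show ?thesis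
    by (simp add: workload_def Let_def)
qed

lemma epoch_workload_mono: "x \<le> y \<Longrightarrow> epoch_workload x \<tau> s n \<le> epoch_workload y \<tau> s n"
  by (induction n) (auto simp: min_def max_def)

text \<open>Copies driven by the same input keep their order. This later turns a probability of
  separation into a difference of two one-copy probabilities.\<close>

lemma workload_mono: "x \<le> y \<Longrightarrow> workload x \<tau> s t \<le> workload y \<tau> s t"
  using epoch_workload_mono[of x y \<tau> s "arrivals_by \<tau> t"] by (simp add: workload_def Let_def max_def)

section \<open>Integrals, total variation and exponential laws\<close>

abbreviation exp_law :: "real \<Rightarrow> real measure" where
  "exp_law lam \<equiv> density lborel (exponential_density lam)"

lemma AE_exp_law_pos: "AE a in exp_law lam. 0 < a"
proof -
  have "AE a in lborel. a \<noteq> (0::real)" by (rule AE_lborel_singleton)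
  then show ?thesis
    by (subst AE_density) (auto simp: exponential_density_def elim!: eventually_mono)
qed

lemma emeasure_exp_law_atMost:
  "0 < lam \<Longrightarrow> 0 \<le> a \<Longrightarrow> emeasure (exp_law lam) {..a} = ennreal (1 - exp (- lam * a))"
  by (simp add: emeasure_erlang_density erlang_CDF_def)

lemma exp_law_service_law: 
  assumes "0 < mu" shows "exp_law mu \<in> service_laws"
proof -
  interpret prob_space "exp_law mu" using assms by (rule prob_space_exponential_density)
  have "emeasure (exp_law mu) {0<..} = 1"
    using AE_exp_law_pos[of mu] by (intro emeasure_eq_1_AE) auto
  then show ?thesis by (simp add: service_laws_def prob_space_axioms)
qed

text \<open>The common end of the contraction arguments: \<open>n\<close> iterations leave a
  geometrically small error, and \<open>n\<close> tends to infinity.\<close>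

lemma ennreal_le_if_le_add_power:
  fixes u v :: ennreal
  assumes "0 \<le> c" "c < 1" and le: "\<And>n. u \<le> v + ennreal (C * c ^ n)"
  shows "u \<le> v"
proof -
  have "(\<lambda>n. v + ennreal (C * c ^ n)) \<longlonglongrightarrow> v + ennreal (C * 0)"
    using assms by (intro tendsto_intros tendsto_ennrealI LIMSEQ_realpow_zero)
  then show ?thesis using le by (intro LIMSEQ_le_const) auto
qed

text \<open>Layer-cake representation: \<open>z\<close> is the length of \<open>{a \<in> (0, 1). a < z}\<close>.\<close>

lemma nn_integral_layer_cake:
  assumes "sigma_finite_measure M" and [measurable]: "g \<in> borel_measurable M" and g1: "\<And>x. g x \<le> 1"
  shows "(\<integral>\<^sup>+x. g x \<partial>M) = (\<integral>\<^sup>+a. emeasure M {x \<in> space M. ennreal a < g x} * indicator {0<..<1} a \<partial>lborel)"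
proof -
  interpret M: sigma_finite_measure M by fact
  interpret pair_sigma_finite M lborel ..
  have len: "z = (\<integral>\<^sup>+a. (if ennreal a < z then 1 else 0) * indicator {0<..<1} a \<partial>lborel)"
    if "z \<le> 1" for z :: ennreal
  proof -
    have "z < top" using that ennreal_one_less_top by (rule le_less_trans)
    then obtain r where r: "z = ennreal r" "0 \<le> r" by (cases z) auto
    then have "r \<le> 1" using that by simp
    have "(\<integral>\<^sup>+a. (if ennreal a < z then 1 else 0) * indicator {0<..<1} a \<partial>lborel) =
        (\<integral>\<^sup>+a. indicator {0<..<r} a \<partial>lborel)"
      using r \<open>r \<le> 1\<close> by (intro nn_integral_cong) (auto simp: ennreal_less_iff split: split_indicator)
    then show ?thesis using r by simp
  qed
  have "(\<integral>\<^sup>+x. g x \<partial>M) =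
      (\<integral>\<^sup>+x. \<integral>\<^sup>+a. (if ennreal a < g x then 1 else 0) * indicator {0<..<1} a \<partial>lborel \<partial>M)"
    using len g1 by (intro nn_integral_cong) blast
  also have "\<dots> = (\<integral>\<^sup>+a. \<integral>\<^sup>+x. (if ennreal a < g x then 1 else 0) * indicator {0<..<1} a \<partial>M \<partial>lborel)"
    by (rule Fubini'[symmetric]) measurable
  also have "\<dots> = (\<integral>\<^sup>+a. emeasure M {x \<in> space M. ennreal a < g x} * indicator {0<..<1} a \<partial>lborel)"
  proof (rule nn_integral_cong)
    fix a :: real
    have "(\<integral>\<^sup>+x. (if ennreal a < g x then 1 else 0) * indicator {0<..<1} a \<partial>M) =
      (\<integral>\<^sup>+x. indicator {x \<in> space M. ennreal a < g x} x * indicator {0<..<1} a \<partial>M)"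
      by (intro nn_integral_cong) (auto split: split_indicator)
    then show "(\<integral>\<^sup>+x. (if ennreal a < g x then 1 else 0) * indicator {0<..<1} a \<partial>M) =
      emeasure M {x \<in> space M. ennreal a < g x} * indicator {0<..<1} a"
      by (simp add: nn_integral_multc)
  qed
  finally show ?thesis .
qed

text \<open>By the layer-cake formula only the superlevel sets of \<open>g\<close> enter, and the
  levels fill an interval of length 1, so the uniform error \<open>c\<close> is counted exactly
  once.\<close>

lemma nn_integral_le_if_emeasure_le:
  assumes M: "prob_space M" "sets M = sets borel" and N: "prob_space N" "sets N = sets borel"
    and le: "\<And>A. A \<in> sets borel \<Longrightarrow> emeasure M A \<le> emeasure N A + c"
    and g [measurable]: "g \<in> borel_measurable borel" and g1: "\<And>x. g x \<le> 1"
  shows "(\<integral>\<^sup>+x. g x \<partial>M) \<le> (\<integral>\<^sup>+x. g x \<partial>N) + c"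
proof -
  interpret M: prob_space M by fact
  interpret N: prob_space N by fact
  have gM [measurable]: "g \<in> borel_measurable M" and gN [measurable]: "g \<in> borel_measurable N"
    using g M(2) N(2) by (simp_all cong: measurable_cong_sets)
  have space: "space M = space N"
    using M(2) N(2) by (metis sets_eq_imp_space_eq)
  interpret pair_sigma_finite N lborel ..
  have [measurable]: "(\<lambda>a. emeasure N {x \<in> space N. ennreal a < g x}) \<in> borel_measurable lborel"
    by measurable
  have "(\<integral>\<^sup>+x. g x \<partial>M) = (\<integral>\<^sup>+a. emeasure M {x \<in> space M. ennreal a < g x} * indicator {0<..<1} a \<partial>lborel)"
    by (rule nn_integral_layer_cake[OF M.sigma_finite_measure_axioms gM g1])
  also have "\<dots> \<le> (\<integral>\<^sup>+a. (emeasure N {x \<in> space N. ennreal a < g x} + c) * indicator {0<..<1} a \<partial>lborel)"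
  proof (intro nn_integral_mono mult_right_mono)
    fix a :: real
    have "{x \<in> space N. ennreal a < g x} \<in> sets N" by measurable
    then show "emeasure M {x \<in> space M. ennreal a < g x} \<le> emeasure N {x \<in> space N. ennreal a < g x} + c"
      unfolding space N(2) by (rule le)
  qed simp
  also have "\<dots> = (\<integral>\<^sup>+a. emeasure N {x \<in> space N. ennreal a < g x} * indicator {0<..<1} a +
      c * indicator {0<..<1} a \<partial>lborel)"
    by (intro nn_integral_cong) (simp add: distrib_right)
  also have "\<dots> = (\<integral>\<^sup>+a. emeasure N {x \<in> space N. ennreal a < g x} * indicator {0<..<1} a \<partial>lborel) + c"
    by (subst nn_integral_add) (auto simp: nn_integral_cmult)
  also have "\<dots> = (\<integral>\<^sup>+x. g x \<partial>N) + c"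
    by (subst nn_integral_layer_cake[OF N.sigma_finite_measure_axioms gN g1]) simp
  finally show ?thesis .
qed

text \<open>Integrate over \<open>x\<close> with \<open>y\<close> fixed, then average over
  \<open>y\<close>; total mass 1 preserves the error \<open>c\<close>.\<close>

lemma nn_integral_le_if_oscillation_le:
  assumes M: "prob_space M" "AE x in M. x \<in> S" and N: "prob_space N" "AE x in N. x \<in> S"
    and f: "f \<in> borel_measurable N"
    and le: "\<And>x y. x \<in> S \<Longrightarrow> y \<in> S \<Longrightarrow> f x \<le> f y + c"
  shows "(\<integral>\<^sup>+x. f x \<partial>M) \<le> (\<integral>\<^sup>+x. f x \<partial>N) + c"
proof -
  interpret M: prob_space M by fact
  interpret N: prob_space N by fact
  have 1: "(\<integral>\<^sup>+x. f x \<partial>M) \<le> f y + c" if "y \<in> S" for y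
    using M(2) le[OF _ that] by (intro M.nn_integral_le_const) (auto elim: eventually_mono)
  have "(\<integral>\<^sup>+x. f x \<partial>M) = (\<integral>\<^sup>+y. (\<integral>\<^sup>+x. f x \<partial>M) \<partial>N)"
    by (simp add: N.emeasure_space_1)
  also have "\<dots> \<le> (\<integral>\<^sup>+y. f y + c \<partial>N)"
    using N(2) 1 by (intro nn_integral_mono_AE) (auto elim: eventually_mono)
  also have "\<dots> = (\<integral>\<^sup>+y. f y \<partial>N) + c"
    using f by (subst nn_integral_add) (auto simp: N.emeasure_space_1)
  finally show ?thesis .
qed

section \<open>Integrals of exponentially damped sines\<close>

lemma FTC_le_nn_integral:
  fixes F f :: "real \<Rightarrow> real"
  assumes "a \<le> b" "\<And>x. a \<le> x \<Longrightarrow> x \<le> b \<Longrightarrow> (F has_real_derivative f x) (at x)"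
    and f: "continuous_on {a..b} f"
  shows "ennreal (F b - F a) \<le> (\<integral>\<^sup>+x. ennreal (f x) * indicator {a..b} x \<partial>lborel)"
proof -
  let ?f = "\<lambda>x. indicator {a..b} x *\<^sub>R f x"
  have int: "integrable lborel ?f"
    using borel_integrable_atLeastAtMost'[OF f] by (simp add: set_integrable_def)
  have "F b - F a = integral\<^sup>L lborel ?f"
    using assms by (intro integral_FTC_atLeastAtMost[symmetric])
      (auto intro: has_vector_derivative_at_within simp: has_real_derivative_iff_has_vector_derivative)
  \<comment> \<open>Only an inequality, because \<open>ennreal\<close> cuts the negative part of
    \<open>f\<close> off to 0; \<open>f\<close> may change sign.\<close>
  also have "\<dots> \<le> enn2real (\<integral>\<^sup>+x. ennreal (?f x) \<partial>lborel)"
    using int by (simp add: real_lebesgue_integral_def)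
  finally have "ennreal (F b - F a) \<le> ennreal (enn2real (\<integral>\<^sup>+x. ennreal (?f x) \<partial>lborel))"
    by (rule ennreal_leI)
  also have "\<dots> = (\<integral>\<^sup>+x. ennreal (?f x) \<partial>lborel)"
    using int by (intro ennreal_enn2real) (simp add: real_integrable_def less_top)
  also have "\<dots> = (\<integral>\<^sup>+x. ennreal (f x) * indicator {a..b} x \<partial>lborel)"
    by (intro nn_integral_cong) (simp split: split_indicator)
  finally show ?thesis .
qed

lemma DERIV_exp_sin_cos:
  fixes m :: real
  shows "((\<lambda>b. - (exp (- m * b) * (m * sin (k * (y + b)) + k * cos (k * (y + b))))) has_real_derivative
    exp (- m * b) * sin (k * (y + b)) * (m\<^sup>2 + k\<^sup>2)) (at b)"
  by (rule derivative_eq_intros refl | simp add: algebra_simps power2_eq_square)+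

text \<open>The combination \<open>m * sin + k * cos\<close> is the one that integration over the
  service time produces, so this is the antiderivative needed for the subsequent integration over
  the arrival time.\<close>

lemma DERIV_exp_sin:
  fixes m :: real
  shows "((\<lambda>a. - (exp (- m * a) * sin (k * (x - a)))) has_real_derivative
    exp (- m * a) * (m * sin (k * (x - a)) + k * cos (k * (x - a)))) (at a)"
  by (rule derivative_eq_intros refl | simp add: algebra_simps)+

lemma ennreal_add_le: "0 \<le> a \<Longrightarrow> ennreal (a + b) \<le> ennreal a + ennreal b"
  by (cases "0 \<le> b") (auto simp: ennreal_neg intro!: ennreal_leI)

lemma nn_integral_exp_law:
  assumes [measurable]: "f \<in> borel_measurable borel"
  shows "(\<integral>\<^sup>+a. f a \<partial>exp_law l) = (\<integral>\<^sup>+a. ennreal (exponential_density l a) * f a \<partial>lborel)"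
  by (subst nn_integral_density) auto

section \<open>Total variation distance\<close>

lemma abs_measure_diff_le_1:
  assumes "prob_space M" "prob_space N"
  shows "\<bar>measure M A - measure N A\<bar> \<le> 1"
proof -
  interpret M: prob_space M by fact
  interpret N: prob_space N by fact
  show ?thesis
    using M.prob_le_1[of A] N.prob_le_1[of A]
    by (auto simp: abs_le_iff algebra_simps intro: add_increasing add_increasing2)
qed

lemma abs_measure_diff_le_tv_dist:
  assumes "prob_space M" "prob_space N" "A \<in> sets borel"
  shows "\<bar>measure M A - measure N A\<bar> \<le> tv_dist M N"
proof -
  have "bdd_above ((\<lambda>A. \<bar>measure M A - measure N A\<bar>) ` sets borel)"
    using abs_measure_diff_le_1[OF assms(1,2)] by (intro bdd_aboveI2)
  then show ?thesis
    unfolding tv_dist_def using assms(3) by (rule cSUP_upper2[OF _ _ order_refl])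
qed

lemma tv_dist_nonneg: "prob_space M \<Longrightarrow> prob_space N \<Longrightarrow> 0 \<le> tv_dist M N"
  using abs_measure_diff_le_tv_dist[of M N "{}"] by simp

lemma tv_dist_le_1:
  assumes "prob_space M" "prob_space N"
  shows "tv_dist M N \<le> 1"
  unfolding tv_dist_def using abs_measure_diff_le_1[OF assms] by (intro cSUP_least) auto

section \<open>Renewal equation and Markov property\<close>

locale truncated_queue =
  fixes G :: "real measure" and lam :: real
  assumes G: "G \<in> service_laws" and lam: "0 < lam"
begin

abbreviation "E \<equiv> exp_law lam"
abbreviation "I \<equiv> input_space G lam"

lemma sets_G [measurable_cong, simp]: "sets G = sets borel"
  using G by (simp add: service_laws_def)

sublocale G: prob_space G
  using G by (simp add: service_laws_def)

sublocale E: prob_space E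
  using lam by (rule prob_space_exponential_density)

sublocale I: prob_space I
  by (rule prob_space_input_space[OF G lam])

sublocale ES: sequence_space E
  by standard

sublocale GS: sequence_space G
  by standard

lemma I_eq: "I = ES.S \<Otimes>\<^sub>M GS.S"
  by (simp add: input_space_def)

lemma sets_I [measurable_cong]: "sets I = sets ((\<Pi>\<^sub>M i\<in>UNIV. borel) \<Otimes>\<^sub>M (\<Pi>\<^sub>M i\<in>UNIV. borel))"
  unfolding input_space_def by (intro sets_pair_measure_cong sets_PiM_cong) auto

lemma nn_integral_I:
  assumes [measurable]: "F \<in> borel_measurable I"
  shows "(\<integral>\<^sup>+w. F w \<partial>I) = (\<integral>\<^sup>+\<tau>. \<integral>\<^sup>+s. F (\<tau>, s) \<partial>GS.S \<partial>ES.S)"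
  unfolding I_eq by (rule GS.nn_integral_fst[symmetric]) (simp add: I_eq[symmetric])

text \<open>An i.i.d. sequence has the law of a first entry followed by an independent copy of the
  sequence. This is applied to services and to gaps; Fubini then moves the first service outside the
  remaining gaps.\<close>

lemma nn_integral_I_first_arrival:
  assumes F [measurable]: "F \<in> borel_measurable I"
  shows "(\<integral>\<^sup>+w. F w \<partial>I) =
    (\<integral>\<^sup>+a. \<integral>\<^sup>+b. \<integral>\<^sup>+w. F (case_nat a (fst w), case_nat b (snd w)) \<partial>I \<partial>G \<partial>E)"
proof -
  have [measurable]: "F \<in> borel_measurable ((\<Pi>\<^sub>M i\<in>UNIV. borel) \<Otimes>\<^sub>M (\<Pi>\<^sub>M i\<in>UNIV. borel))"
    using F by (simp cong: measurable_cong_sets add: sets_I)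
  interpret ESG: pair_sigma_finite G ES.S ..
  have service: "(\<integral>\<^sup>+s. F (\<sigma>, s) \<partial>GS.S) = (\<integral>\<^sup>+b. \<integral>\<^sup>+s. F (\<sigma>, case_nat b s) \<partial>GS.S \<partial>G)" for \<sigma>
  proof -
    have "Pair \<sigma> \<in> GS.S \<rightarrow>\<^sub>M (\<Pi>\<^sub>M i\<in>UNIV. borel) \<Otimes>\<^sub>M (\<Pi>\<^sub>M i\<in>UNIV. borel)"
      by (subst measurable_cong_sets[OF sets_PiM_cong[OF refl sets_G] refl], rule measurable_Pair1')
        (simp add: space_PiM)
    then have [measurable]: "(\<lambda>s. F (\<sigma>, s)) \<in> borel_measurable GS.S"
      by (rule measurable_compose) measurable
    have "(\<integral>\<^sup>+s. F (\<sigma>, s) \<partial>GS.S) =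
        (\<integral>\<^sup>+s. F (\<sigma>, s) \<partial>distr (G \<Otimes>\<^sub>M GS.S) GS.S (\<lambda>(b, s). case_nat b s))"
      by (simp only: GS.PiM_iter)
    also have "\<dots> = (\<integral>\<^sup>+p. F (\<sigma>, case_nat (fst p) (snd p)) \<partial>(G \<Otimes>\<^sub>M GS.S))"
      by (subst nn_integral_distr) (auto simp: case_prod_beta')
    also have "\<dots> = (\<integral>\<^sup>+b. \<integral>\<^sup>+s. F (\<sigma>, case_nat b s) \<partial>GS.S \<partial>G)"
      by (subst GS.nn_integral_fst[symmetric]) (auto intro: measurable_compose[OF _ \<open>(\<lambda>s. F (\<sigma>, s)) \<in> borel_measurable GS.S\<close>])
    finally show ?thesis .
  qed
  have "(\<integral>\<^sup>+w. F w \<partial>I) = (\<integral>\<^sup>+\<tau>. \<integral>\<^sup>+s. F (\<tau>, s) \<partial>GS.S \<partial>ES.S)"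
    by (rule nn_integral_I) measurable
  also have "\<dots> = (\<integral>\<^sup>+\<tau>. \<integral>\<^sup>+s. F (\<tau>, s) \<partial>GS.S \<partial>distr (E \<Otimes>\<^sub>M ES.S) ES.S (\<lambda>(a, \<tau>). case_nat a \<tau>))"
    by (simp only: ES.PiM_iter)
  also have "\<dots> = (\<integral>\<^sup>+a. \<integral>\<^sup>+\<tau>. \<integral>\<^sup>+s. F (case_nat a \<tau>, s) \<partial>GS.S \<partial>ES.S \<partial>E)"
    by (subst nn_integral_distr) (auto simp: ES.nn_integral_fst[symmetric] case_prod_beta')
  also have "\<dots> = (\<integral>\<^sup>+a. \<integral>\<^sup>+\<tau>. \<integral>\<^sup>+b. \<integral>\<^sup>+s. F (case_nat a \<tau>, case_nat b s) \<partial>GS.S \<partial>G \<partial>ES.S \<partial>E)"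
    by (intro nn_integral_cong service)
  also have "\<dots> = (\<integral>\<^sup>+a. \<integral>\<^sup>+b. \<integral>\<^sup>+\<tau>. \<integral>\<^sup>+s. F (case_nat a \<tau>, case_nat b s) \<partial>GS.S \<partial>ES.S \<partial>G \<partial>E)"
    by (intro nn_integral_cong ESG.Fubini') measurable
  also have "\<dots> = (\<integral>\<^sup>+a. \<integral>\<^sup>+b. \<integral>\<^sup>+w. F (case_nat a (fst w), case_nat b (snd w)) \<partial>I \<partial>G \<partial>E)"
    by (subst nn_integral_I) (auto)
  finally show ?thesis .
qed

section \<open>Almost sure behaviour of the arrival epochs\<close>

lemma AE_I_arrivals: 
  assumes "AE \<tau> in ES.S. P \<tau>"
  shows "AE w in I. P (fst w)"
proof -
  have distr: "distr I ES.S fst = ES.S"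
    unfolding I_eq by (intro prob_space.distr_pair_fst prob_space_PiM G.prob_space_axioms)
  have "fst \<in> I \<rightarrow>\<^sub>M ES.S"
    unfolding I_eq by measurable
  then show ?thesis
    by (rule AE_distrD) (use assms in \<open>simp only: distr\<close>)
qed

lemma AE_long_gap: "AE \<tau> in ES.S. \<exists>i\<ge>m. 1 \<le> \<tau> i"
proof -
  let ?c = "1 - exp (- lam)"
  define B where "B k = {\<tau> \<in> space ES.S. \<forall>i\<in>{m..<m+k}. \<tau> i \<in> {..1}}" for k
  have [measurable]: "B k \<in> sets ES.S" for k
    unfolding B_def by measurable
  \<comment> \<open>By independence, \<open>k\<close> consecutive gaps are all at most 1 with
    probability \<open>?c ^ k\<close>, which tends to 0.\<close>
  have B: "emeasure ES.S (B k) = ennreal (?c ^ k)" for k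
    unfolding B_def using lam
    by (subst ES.emeasure_PiM_Collect) (auto simp: emeasure_exp_law_atMost ennreal_power)
  have "(\<lambda>k. ennreal (?c ^ k)) \<longlonglongrightarrow> ennreal 0"
    using lam by (intro tendsto_ennrealI LIMSEQ_realpow_zero) auto
  moreover have "emeasure ES.S (\<Inter>k. B k) \<le> ennreal (?c ^ k)" for k
    unfolding B[symmetric] by (intro emeasure_mono) auto
  ultimately have "emeasure ES.S (\<Inter>k. B k) \<le> ennreal 0"
    by (intro LIMSEQ_le_const) auto
  then have "(\<Inter>k. B k) \<in> null_sets ES.S" by auto
  then show ?thesis
  proof (rule AE_I')
    show "{\<tau> \<in> space ES.S. \<not> (\<exists>i\<ge>m. 1 \<le> \<tau> i)} \<subseteq> (\<Inter>k. B k)"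
      unfolding B_def by (auto simp flip: not_less dest: less_imp_le)
  qed
qed

lemma AE_gaps_pos: "AE \<tau> in ES.S. \<forall>i. 0 < \<tau> i"
proof (subst AE_all_countable, rule)
  show "AE \<tau> in ES.S. 0 < \<tau> i" for i
    by (rule AE_PiM_component) (auto intro: ES.prob_space AE_exp_law_pos E.prob_space_axioms)
qed

text \<open>Infinitely many gaps are at least 1 and each lifts the epochs by 1. This discards the
  null event on which \<open>arrivals_by\<close> has no witness.\<close>

lemma AE_arrivals_unbounded: "AE w in I. \<forall>t. \<exists>n. t < arrival (fst w) n"
proof (rule AE_I_arrivals)
  have "AE \<tau> in ES.S. \<forall>m. \<exists>i\<ge>m. 1 \<le> \<tau> i"
    by (subst AE_all_countable) (auto intro: AE_long_gap)
  with AE_gaps_pos show "AE \<tau> in ES.S. \<forall>t. \<exists>n. t < arrival \<tau> n"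
  proof eventually_elim
    fix \<tau> :: "nat \<Rightarrow> real" assume pos: "\<forall>i. 0 < \<tau> i" and long: "\<forall>m. \<exists>i\<ge>m. 1 \<le> \<tau> i"
    have "\<exists>n. real k \<le> arrival \<tau> n" for k
    proof (induction k)
      case 0
      show ?case by (intro exI[of _ 0]) (simp add: arrival_def)
    next
      case (Suc k)
      then obtain n where n: "real k \<le> arrival \<tau> n" by auto
      obtain i where i: "n \<le> i" "1 \<le> \<tau> i" using long by blast
      have "arrival \<tau> n \<le> arrival \<tau> i"
        unfolding arrival_def using i pos by (intro sum_mono2) (auto simp: less_imp_le)
      with i n show ?case by (intro exI[of _ "Suc i"]) (simp add: arrival_def)
    qed
    then show "\<forall>t. \<exists>n. t < arrival \<tau> n"
      by (meson reals_Archimedean2 less_le_trans)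
  qed
qed

section \<open>Renewal equation for one copy and for two coupled copies\<close>

abbreviation jump :: "real \<Rightarrow> real \<Rightarrow> real \<Rightarrow> real" where
  "jump a b x \<equiv> min (b + max (x - a) 0) 1"

text \<open>Synchronous coupling: both copies read the same input \<open>w\<close>.\<close>

definition two_point :: "real \<Rightarrow> (real \<times> real \<Rightarrow> ennreal) \<Rightarrow> real \<Rightarrow> real \<Rightarrow> ennreal" where
  "two_point t f x y =
    (\<integral>\<^sup>+w. f (workload x (fst w) (snd w) t, workload y (fst w) (snd w) t) \<partial>I)"

lemma measurable_two_point [measurable (raw)]:
  assumes [measurable]: "f \<in> borel_measurable (borel \<Otimes>\<^sub>M borel)"
    "g \<in> borel_measurable M" "h \<in> borel_measurable M" "k \<in> borel_measurable M"
  shows "(\<lambda>w. two_point (g w) f (h w) (k w)) \<in> borel_measurable M"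
  unfolding two_point_def by measurable

text \<open>Condition on the first arrival time \<open>a\<close>. If \<open>t < a\<close>, both
  copies have merely drained; otherwise they restart from their post-jump states with time
  \<open>t - a\<close> left.\<close>

lemma two_point_renewal:
  assumes [measurable]: "f \<in> borel_measurable (borel \<Otimes>\<^sub>M borel)"
  shows "two_point t f x y = (\<integral>\<^sup>+a. (if t < a then f (max (x - t) 0, max (y - t) 0)
      else \<integral>\<^sup>+b. two_point (t - a) f (jump a b x) (jump a b y) \<partial>G) \<partial>E)"
proof -
  have "two_point t f x y = (\<integral>\<^sup>+a. \<integral>\<^sup>+b. \<integral>\<^sup>+w.
      f (workload x (case_nat a (fst w)) (case_nat b (snd w)) t,
         workload y (case_nat a (fst w)) (case_nat b (snd w)) t) \<partial>I \<partial>G \<partial>E)"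
    unfolding two_point_def by (subst nn_integral_I_first_arrival) auto
  also have "\<dots> = (\<integral>\<^sup>+a. (if t < a then f (max (x - t) 0, max (y - t) 0)
      else \<integral>\<^sup>+b. two_point (t - a) f (jump a b x) (jump a b y) \<partial>G) \<partial>E)"
  proof (rule nn_integral_cong)
    fix a :: real
    show "(\<integral>\<^sup>+b. \<integral>\<^sup>+w. f (workload x (case_nat a (fst w)) (case_nat b (snd w)) t,
         workload y (case_nat a (fst w)) (case_nat b (snd w)) t) \<partial>I \<partial>G) =
      (if t < a then f (max (x - t) 0, max (y - t) 0)
      else \<integral>\<^sup>+b. two_point (t - a) f (jump a b x) (jump a b y) \<partial>G)"
    proof (cases "t < a")
      case True
      then show ?thesis
        by (simp add: workload_before_first_arrival G.emeasure_space_1 I.emeasure_space_1)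
    next
      case False
      have "(\<integral>\<^sup>+w. f (workload x (case_nat a (fst w)) (case_nat b (snd w)) t,
         workload y (case_nat a (fst w)) (case_nat b (snd w)) t) \<partial>I) =
         two_point (t - a) f (jump a b x) (jump a b y)" for b
        unfolding two_point_def using AE_arrivals_unbounded False
        by (intro nn_integral_cong_AE)
          (auto elim!: eventually_mono simp: workload_after_first_arrival)
      with False show ?thesis by simp
    qed
  qed
  finally show ?thesis .
qed

text \<open>The transition semigroup acting on functions.\<close>

definition P :: "real \<Rightarrow> (real \<Rightarrow> ennreal) \<Rightarrow> real \<Rightarrow> ennreal" where
  "P t f x = (\<integral>\<^sup>+w. f (workload x (fst w) (snd w) t) \<partial>I)"

lemma measurable_P [measurable (raw)]:
  assumes [measurable]: "f \<in> borel_measurable borel"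
    "g \<in> borel_measurable M" "h \<in> borel_measurable M"
  shows "(\<lambda>w. P (g w) f (h w)) \<in> borel_measurable M"
  unfolding P_def by measurable

lemma P_renewal:
  assumes [measurable]: "f \<in> borel_measurable borel"
  shows "P t f x = (\<integral>\<^sup>+a. (if t < a then f (max (x - t) 0)
      else \<integral>\<^sup>+b. P (t - a) f (jump a b x) \<partial>G) \<partial>E)"
  using two_point_renewal[of "\<lambda>p. f (fst p)" t x x]
  by (simp add: two_point_def P_def cong: if_cong)

lemma P_le_1: "(\<And>y. f y \<le> 1) \<Longrightarrow> P t f x \<le> 1"
  unfolding P_def by (intro I.nn_integral_le_const) auto

lemma nn_integral_E_atMost: "0 \<le> s \<Longrightarrow> (\<integral>\<^sup>+a. indicator {..s} a \<partial>E) = ennreal (1 - exp (- lam * s))"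
  using lam by (simp add: emeasure_exp_law_atMost)

lemma memoryless:
  assumes [measurable]: "h \<in> borel_measurable borel" and s: "0 \<le> s"
  shows "(\<integral>\<^sup>+a. h a * indicator {s<..} a \<partial>E) = ennreal (exp (- lam * s)) * (\<integral>\<^sup>+a. h (s + a) \<partial>E)"
proof -
  have "(\<integral>\<^sup>+a. h a * indicator {s<..} a \<partial>E) =
      (\<integral>\<^sup>+a. exponential_density lam a * (h a * indicator {s<..} a) \<partial>lborel)"
    by (subst nn_integral_density) auto
  also have "\<dots> = (\<integral>\<^sup>+a. exponential_density lam (s + 1 * a) * (h (s + 1 * a) * indicator {s<..} (s + 1 * a)) \<partial>lborel)"
    by (subst nn_integral_real_affine[where c=1 and t=s]) auto
  also have "\<dots> = (\<integral>\<^sup>+a. ennreal (exp (- lam * s)) * (exponential_density lam a * h (s + a)) \<partial>lborel)"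
  proof (rule nn_integral_cong_AE)
    \<comment> \<open>At \<open>a = 0\<close> the two sides can differ: the indicator of
      \<open>{s<..}\<close> vanishes at \<open>s\<close>, whereas the density at 0 is
      \<open>lam\<close>.\<close>
    have "AE a in lborel. a \<noteq> (0::real)" by (rule AE_lborel_singleton)
    then show "AE a in lborel. exponential_density lam (s + 1 * a) *
        (h (s + 1 * a) * indicator {s<..} (s + 1 * a)) =
      ennreal (exp (- lam * s)) * (exponential_density lam a * h (s + a))"
    proof eventually_elim
      fix a :: real assume "a \<noteq> 0"
      then show "exponential_density lam (s + 1 * a) *
          (h (s + 1 * a) * indicator {s<..} (s + 1 * a)) =
        ennreal (exp (- lam * s)) * (exponential_density lam a * h (s + a))"
      proof (cases "0 < a")
        case True
        then have "exponential_density lam (s + a) = exp (- lam * s) * exponential_density lam a"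
          using s by (simp add: exponential_density_def exp_add[symmetric] algebra_simps)
        then have "ennreal (exponential_density lam (s + a)) =
            ennreal (exp (- lam * s)) * ennreal (exponential_density lam a)"
          by (simp add: ennreal_mult')
        with True show ?thesis by (simp add: mult.assoc)
      qed (use \<open>a \<noteq> 0\<close> in \<open>simp add: exponential_density_def\<close>)
    qed
  qed
  also have "\<dots> = ennreal (exp (- lam * s)) * (\<integral>\<^sup>+a. h (s + a) \<partial>E)"
    by (subst nn_integral_cmult) (auto simp: nn_integral_density)
  finally show ?thesis .
qed

text \<open>The renewal equation is a contraction on every bounded time interval, with constant
  \<open>P(\<tau> \<le> s0) < 1\<close>.\<close>

lemma renewal_comparison:
  assumes u [measurable]: "case_prod u \<in> borel_measurable (borel \<Otimes>\<^sub>M borel)"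
    and v [measurable]: "case_prod v \<in> borel_measurable (borel \<Otimes>\<^sub>M borel)"
    and u1: "\<And>s x. u s x \<le> 1"
    and ru: "\<And>s x. 0 \<le> s \<Longrightarrow>
      u s x = (\<integral>\<^sup>+a. (if s < a then g s x else \<integral>\<^sup>+b. u (s - a) (jump a b x) \<partial>G) \<partial>E)"
    and rv: "\<And>s x. 0 \<le> s \<Longrightarrow>
      v s x = (\<integral>\<^sup>+a. (if s < a then g s x else \<integral>\<^sup>+b. v (s - a) (jump a b x) \<partial>G) \<partial>E)"
    and "0 \<le> s"
  shows "u s x \<le> v s x"
proof -
  \<comment> \<open>The horizon is frozen so that \<open>c\<close> stays constant while the
    induction lets \<open>s\<close> range over \<open>[0, s0]\<close>.\<close>
  define s0 where "s0 = s"
  have s0: "0 \<le> s0" using \<open>0 \<le> s\<close> by (simp add: s0_def)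
  define c where "c = 1 - exp (- lam * s0)"
  have c: "0 \<le> c" "c < 1" using lam s0 by (auto simp: c_def)
  have "u s x \<le> v s x + ennreal (c ^ n)" if "0 \<le> s" "s \<le> s0" for n s x
    using that
  proof (induction n arbitrary: s x)
    case 0
    then show ?case using u1[of s x] by (simp add: add_increasing)
  next
    case (Suc n)
    have "u s x \<le> (\<integral>\<^sup>+a. (if s < a then g s x else \<integral>\<^sup>+b. v (s - a) (jump a b x) \<partial>G) +
        ennreal (c ^ n) * indicator {..s0} a \<partial>E)"
      unfolding ru[OF Suc.prems(1)]
    proof (intro nn_integral_mono_AE eventually_mono[OF AE_exp_law_pos])
      fix a :: real assume a: "0 < a"
      show "(if s < a then g s x else \<integral>\<^sup>+b. u (s - a) (jump a b x) \<partial>G) \<le>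
        (if s < a then g s x else \<integral>\<^sup>+b. v (s - a) (jump a b x) \<partial>G) +
          ennreal (c ^ n) * indicator {..s0} a"
      proof (cases "s < a")
        case True
        then show ?thesis by simp
      next
        case False
        have "(\<integral>\<^sup>+b. u (s - a) (jump a b x) \<partial>G) \<le> (\<integral>\<^sup>+b. v (s - a) (jump a b x) + ennreal (c ^ n) \<partial>G)"
          using False a Suc.prems by (intro nn_integral_mono Suc.IH) auto
        also have "\<dots> = (\<integral>\<^sup>+b. v (s - a) (jump a b x) \<partial>G) + ennreal (c ^ n)"
          by (subst nn_integral_add) (auto simp: G.emeasure_space_1)
        finally show ?thesis using False Suc.prems by simp
      qed
    qed
    also have "\<dots> = v s x + ennreal (c ^ n) * ennreal c"
      unfolding rv[OF Suc.prems(1)] c_def nn_integral_E_atMost[OF s0, symmetric]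
      by (subst nn_integral_add) (auto simp: nn_integral_cmult)
    also have "ennreal (c ^ n) * ennreal c = ennreal (c ^ Suc n)"
      using c by (simp add: ennreal_mult'[symmetric] mult.commute)
    finally show ?case .
  qed
  then have le: "u s x \<le> v s x + ennreal (c ^ n)" for n
    using \<open>0 \<le> s\<close> by (simp add: s0_def)
  show ?thesis
    by (rule ennreal_le_if_le_add_power[where C=1, OF c]) (use le in simp)
qed

lemma split_first_arrival:
  assumes [measurable]: "X \<in> borel_measurable borel" "Y \<in> borel_measurable borel"
  shows "(\<integral>\<^sup>+a. (if s < a then X a else Y a) \<partial>E) =
    (\<integral>\<^sup>+a. X a * indicator {s<..} a \<partial>E) + (\<integral>\<^sup>+a. Y a * indicator {..s} a \<partial>E)"
  by (subst nn_integral_add[symmetric]) (auto intro!: nn_integral_cong split: split_indicator)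

text \<open>Both sides, as functions of \<open>s\<close> and \<open>x\<close>, are bounded by 1 and
  solve the same renewal equation, with value \<open>P t f (max (x - s) 0)\<close> when no arrival
  occurs up to \<open>s\<close>. Comparison in both directions identifies them.\<close>

lemma Chapman_Kolmogorov:
  assumes f [measurable]: "f \<in> borel_measurable borel" and f1: "\<And>y. f y \<le> 1"
    and "0 \<le> s" "0 \<le> t"
  shows "P (s + t) f x = P s (P t f) x"
proof -
  have [measurable]: "P t f \<in> borel_measurable borel" by measurable
  have 1: "P (s + t) f x = (\<integral>\<^sup>+a. (if s < a then P t f (max (x - s) 0)
      else \<integral>\<^sup>+b. P ((s - a) + t) f (jump a b x) \<partial>G) \<partial>E)" if s: "0 \<le> s" for s x
  proof -
    let ?z = "max (x - s) 0"
    let ?X = "\<lambda>a. if s + t < a then f (max (x - (s + t)) 0) else \<integral>\<^sup>+b. P (s + t - a) f (jump a b x) \<partial>G"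
    let ?Y = "\<lambda>a. \<integral>\<^sup>+b. P ((s - a) + t) f (jump a b x) \<partial>G"
    have "P (s + t) f x = (\<integral>\<^sup>+a. (if s < a then ?X a else ?Y a) \<partial>E)"
      unfolding P_renewal[OF f, of "s + t" x] using \<open>0 \<le> t\<close>
      by (intro nn_integral_cong) (auto simp: algebra_simps)
    also have "\<dots> = (\<integral>\<^sup>+a. ?X a * indicator {s<..} a \<partial>E) + (\<integral>\<^sup>+a. ?Y a * indicator {..s} a \<partial>E)"
      by (rule split_first_arrival) measurable
    also have "(\<integral>\<^sup>+a. ?X a * indicator {s<..} a \<partial>E) = ennreal (exp (- lam * s)) * (\<integral>\<^sup>+a. ?X (s + a) \<partial>E)"
      using s by (intro memoryless) auto
    \<comment> \<open>After an idle period of length \<open>s\<close> the residual wait is again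
      exponential, so the process restarts from the drained state \<open>?z\<close>.\<close>
    also have "(\<integral>\<^sup>+a. ?X (s + a) \<partial>E) = P t f ?z"
      unfolding P_renewal[OF f, of t ?z]
    proof (intro nn_integral_cong_AE eventually_mono[OF AE_exp_law_pos])
      fix a :: real assume a: "0 < a"
      then have "max (?z - a) 0 = max (x - (s + a)) 0" by auto
      moreover have "max (?z - t) 0 = max (x - (s + t)) 0" using \<open>0 \<le> t\<close> by auto
      ultimately show "?X (s + a) = (if t < a then f (max (?z - t) 0)
          else \<integral>\<^sup>+b. P (t - a) f (jump a b ?z) \<partial>G)" by simp
    qed
    also have "ennreal (exp (- lam * s)) * P t f ?z = (\<integral>\<^sup>+a. P t f ?z * indicator {s<..} a \<partial>E)"
      using memoryless[of "\<lambda>a. P t f ?z" s] s by (simp add: E.emeasure_space_1[simplified])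
    also have "(\<integral>\<^sup>+a. P t f ?z * indicator {s<..} a \<partial>E) + (\<integral>\<^sup>+a. ?Y a * indicator {..s} a \<partial>E) =
        (\<integral>\<^sup>+a. (if s < a then P t f ?z else ?Y a) \<partial>E)"
      by (rule split_first_arrival[symmetric]) measurable
    finally show ?thesis .
  qed
  have 2: "P s (P t f) x = (\<integral>\<^sup>+a. (if s < a then P t f (max (x - s) 0)
      else \<integral>\<^sup>+b. P (s - a) (P t f) (jump a b x) \<partial>G) \<partial>E)" for s x
    by (rule P_renewal) measurable
  have b: "P s (P t f) x \<le> 1" "P (s + t) f x \<le> 1" for s x
    using f1 by (auto intro!: P_le_1)
  show ?thesis
  proof (rule antisym)
    show "P (s + t) f x \<le> P s (P t f) x"
      by (rule renewal_comparison[where u="\<lambda>s. P (s + t) f", OF _ _ b(2) 1 2 \<open>0 \<le> s\<close>]) measurable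
    show "P s (P t f) x \<le> P (s + t) f x"
      by (rule renewal_comparison[where v="\<lambda>s. P (s + t) f", OF _ _ b(1) 2 1 \<open>0 \<le> s\<close>]) measurable
  qed
qed

section \<open>Invariant law\<close>

lemma AE_workload_unit_interval:
  assumes "x \<in> {0..1}" "0 \<le> t"
  shows "AE w in I. workload x (fst w) (snd w) t \<in> {0..1}"
  using AE_arrivals_unbounded assms
  by (auto elim!: eventually_mono intro: workload_nonneg workload_le_1)

text \<open>The probability that the first gap is at most 1; it bounds the memory kept over one unit
  of time.\<close>

definition \<kappa> :: real where "\<kappa> = 1 - exp (- lam)"

lemma \<kappa>: "0 \<le> \<kappa>" "\<kappa> < 1"
  using lam by (auto simp: \<kappa>_def)

text \<open>If the first gap exceeds 1, then at time 1 all workloads started in \<open>[0, 1]\<close> have met at 0.\<close>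

lemma P_oscillation:
  assumes f [measurable]: "f \<in> borel_measurable borel" and f1: "\<And>y. f y \<le> 1"
    and "x \<in> {0..1}" "y \<in> {0..1}"
  shows "P (real n) f x \<le> P (real n) f y + ennreal (\<kappa> ^ n)"
  using assms(3,4)
proof (induction n arbitrary: x y)
  case 0
  have "P 0 f x \<le> 1" by (rule P_le_1[OF f1])
  then show ?case by (simp add: add_increasing)
next
  case (Suc n)
  let ?W = "\<lambda>x w. workload x (fst w) (snd w) 1"
  \<comment> \<open>Condition on the state at time 1. The induction error is then paid only on the
    event that the first gap is at most 1.\<close>
  have step: "P (real (Suc n)) f z = (\<integral>\<^sup>+w. P (real n) f (?W z w) \<partial>I)" for z
    using Chapman_Kolmogorov[OF f f1, of 1 "real n" z] by (simp add: P_def)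
  have gap: "(\<integral>\<^sup>+w. indicator {..1} (fst w 0) \<partial>I) = ennreal \<kappa>"
    using nn_integral_E_atMost[of 1]
    by (subst nn_integral_I_first_arrival)
      (auto simp: \<kappa>_def I.emeasure_space_1 G.emeasure_space_1)
  have "P (real (Suc n)) f x \<le>
      (\<integral>\<^sup>+w. P (real n) f (?W y w) + ennreal (\<kappa> ^ n) * indicator {..1} (fst w 0) \<partial>I)"
    unfolding step
  proof (rule nn_integral_mono_AE)
    have "AE w in I. ?W x w \<in> {0..1}" "AE w in I. ?W y w \<in> {0..1}"
      using Suc.prems by (auto intro!: AE_workload_unit_interval simp del: atLeastAtMost_iff)
    then show "AE w in I. P (real n) f (?W x w) \<le>
        P (real n) f (?W y w) + ennreal (\<kappa> ^ n) * indicator {..1} (fst w 0)"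
    proof eventually_elim
      case (elim w)
      show ?case
      proof (cases "fst w 0 \<le> 1")
        case True
        then show ?thesis using Suc.IH[OF elim] by simp
      next
        case False
        then show ?thesis using Suc.prems by (simp add: workload_before_first_arrival)
      qed
    qed
  qed
  also have "\<dots> = P (real (Suc n)) f y + ennreal (\<kappa> ^ n) * ennreal \<kappa>"
    unfolding step gap[symmetric]
    by (subst nn_integral_add) (auto simp: nn_integral_cmult)
  also have "ennreal (\<kappa> ^ n) * ennreal \<kappa> = ennreal (\<kappa> ^ Suc n)"
    using \<kappa> by (simp add: ennreal_mult'[symmetric] mult.commute)
  finally show ?case .
qed

section \<open>Laws at a fixed time and their limit\<close>

lemma prob_space_law: "prob_space (workload_law G lam x t)"
  unfolding workload_law_def by (rule I.prob_space_distr) measurable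

lemma sets_law [simp, measurable_cong]: "sets (workload_law G lam x t) = sets borel"
  by (simp add: workload_law_def)

lemma nn_integral_law:
  assumes [measurable]: "f \<in> borel_measurable borel"
  shows "(\<integral>\<^sup>+y. f y \<partial>workload_law G lam x t) = P t f x"
  unfolding workload_law_def P_def by (subst nn_integral_distr) (auto simp: case_prod_beta')

lemma emeasure_law:
  assumes "A \<in> sets borel"
  shows "emeasure (workload_law G lam x t) A = P t (indicator A) x"
  using assms nn_integral_law[of "indicator A" x t] by simp

lemma AE_law:
  assumes "x \<in> {0..1}" "0 \<le> t"
  shows "AE y in workload_law G lam x t. y \<in> {0..1}"
  unfolding workload_law_def using AE_workload_unit_interval[OF assms]
  by (subst AE_distr_iff) (auto simp: case_prod_beta')

text \<open>After time \<open>t\<close> the state is a random point of \<open>[0, 1]\<close>, and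
  \<open>n\<close> further units forget how it compares with the fixed point \<open>y\<close>, up to
  \<open>\<kappa> ^ n\<close>.\<close>

lemma P_approx:
  assumes f [measurable]: "f \<in> borel_measurable borel" and f1: "\<And>y. f y \<le> 1"
    and "x \<in> {0..1}" "y \<in> {0..1}" "0 \<le> t"
  shows "P (t + real n) f x \<le> P (real n) f y + ennreal (\<kappa> ^ n)"
    and "P (real n) f y \<le> P (t + real n) f x + ennreal (\<kappa> ^ n)"
proof -
  have eq: "P (t + real n) f x = (\<integral>\<^sup>+z. P (real n) f z \<partial>workload_law G lam x t)"
    using assms by (subst Chapman_Kolmogorov) (auto simp: nn_integral_law)
  have y: "P (real n) f y = (\<integral>\<^sup>+z. P (real n) f z \<partial>return borel y)"
    by (subst nn_integral_return) auto
  have M: "prob_space (workload_law G lam x t)" "AE z in workload_law G lam x t. z \<in> {0..1}"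
    "prob_space (return borel y)" "AE z in return borel y. z \<in> {0..1}"
    using assms prob_space_law AE_law[of x t]
    by (auto intro: prob_space_return simp: AE_return simp del: atLeastAtMost_iff)
  show "P (t + real n) f x \<le> P (real n) f y + ennreal (\<kappa> ^ n)"
    unfolding eq y
    by (rule nn_integral_le_if_oscillation_le[OF M])
      (auto intro!: P_oscillation[OF f f1] simp del: atLeastAtMost_iff)
  show "P (real n) f y \<le> P (t + real n) f x + ennreal (\<kappa> ^ n)"
    unfolding eq y
    by (rule nn_integral_le_if_oscillation_le[OF M(3,4,1,2)])
      (auto intro!: P_oscillation[OF f f1] simp del: atLeastAtMost_iff)
qed

text \<open>Invariance lets both laws run for \<open>n\<close> units of time without change, after
  which \<open>P_oscillation\<close> bounds their difference by \<open>\<kappa> ^ n\<close>, for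
  every \<open>n\<close>.\<close>

lemma is_invariant_unique:
  assumes "is_invariant G lam \<pi>" "is_invariant G lam \<pi>'"
  shows "\<pi> = \<pi>'"
proof (rule measure_eqI)
  show "sets \<pi> = sets \<pi>'" using assms by (simp add: is_invariant_def)
  fix A assume "A \<in> sets \<pi>"
  then have A [measurable]: "A \<in> sets borel" using assms by (simp add: is_invariant_def)
  have *: "emeasure \<mu> A \<le> emeasure \<nu> A"
    if \<mu>: "is_invariant G lam \<mu>" and \<nu>: "is_invariant G lam \<nu>" for \<mu> \<nu>
  proof (rule ennreal_le_if_le_add_power[where C=1, OF \<kappa>])
    fix n
    have AE: "AE x in \<mu>. x \<in> {0..1}" if "is_invariant G lam \<mu>" for \<mu>
    proof -
      interpret prob_space \<mu> using that by (simp add: is_invariant_def)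
      show ?thesis using that
        by (subst AE_in_set_eq_1) (auto simp: is_invariant_def measure_def)
    qed
    have eq: "emeasure \<mu> A = (\<integral>\<^sup>+x. P (real n) (indicator A) x \<partial>\<mu>)" if "is_invariant G lam \<mu>" for \<mu>
      using that by (simp add: is_invariant_def emeasure_law)
    have "P (real n) (indicator A) \<in> borel_measurable \<nu>"
      using \<nu> by (simp add: is_invariant_def cong: measurable_cong_sets) measurable
    moreover have "prob_space \<mu>" "prob_space \<nu>" using \<mu> \<nu> by (simp_all add: is_invariant_def)
    ultimately show "emeasure \<mu> A \<le> emeasure \<nu> A + ennreal (1 * \<kappa> ^ n)"
      unfolding eq[OF \<mu>] eq[OF \<nu>] mult_1
      by (intro nn_integral_le_if_oscillation_le[OF _ AE[OF \<mu>] _ AE[OF \<nu>]] P_oscillation)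
        (auto split: split_indicator)
  qed
  show "emeasure \<pi> A = emeasure \<pi>' A"
    using *[OF assms] *[OF assms(2,1)] by (rule antisym)
qed

text \<open>By \<open>P_approx\<close> the laws started at 0 are Cauchy uniformly over Borel sets; hence their limit is
  again a measure.\<close>

lemma uniform_limit_law:
  obtains \<pi> where "sets \<pi> = sets borel" "prob_space \<pi>"
    "\<And>A n. A \<in> sets borel \<Longrightarrow> \<bar>measure \<pi> A - measure (workload_law G lam 0 (real n)) A\<bar> \<le> \<kappa> ^ n"
proof -
  define p where "p n A = measure (workload_law G lam 0 (real n)) A" for n A
  interpret L: prob_space "workload_law G lam 0 (real n)" for n by (rule prob_space_law)
  have P_p: "P (real n) (indicator A) 0 = ennreal (p n A)" if "A \<in> sets borel" for n A
    using that by (simp add: p_def emeasure_law[symmetric] L.emeasure_eq_measure)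
  have close: "\<bar>p (k + n) A - p n A\<bar> \<le> \<kappa> ^ n" if A: "A \<in> sets borel" for k n A
  proof -
    have "0 \<le> p n A" "0 \<le> p (k + n) A" by (simp_all add: p_def)
    moreover have "ennreal (p (k + n) A) \<le> ennreal (p n A) + ennreal (\<kappa> ^ n)"
      "ennreal (p n A) \<le> ennreal (p (k + n) A) + ennreal (\<kappa> ^ n)"
      using P_approx[of "indicator A" 0 0 "real k" n] A
      by (simp_all add: P_p[OF A, symmetric] split: split_indicator)
    ultimately show ?thesis
      using \<kappa> by (simp add: ennreal_plus[symmetric] abs_le_iff del: ennreal_plus)
  qed
  have \<kappa>_lim: "(\<lambda>n. \<kappa> ^ n) \<longlonglongrightarrow> 0" using \<kappa> by (rule LIMSEQ_realpow_zero)
  have "Cauchy (\<lambda>n. p n A)" if A: "A \<in> sets borel" for A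
  proof (rule CauchyI)
    fix e :: real assume "0 < e"
    then have "\<forall>\<^sub>F n in sequentially. \<kappa> ^ n < e / 2"
      using order_tendstoD(2)[OF \<kappa>_lim, of "e / 2"] by simp
    then obtain n where n: "\<kappa> ^ n < e / 2" by (auto simp: eventually_sequentially)
    have "norm (p i A - p j A) < e" if "n \<le> i" "n \<le> j" for i j
      using close[OF A, of "i - n" n] close[OF A, of "j - n" n] that n by auto
    then show "\<exists>M. \<forall>m\<ge>M. \<forall>n\<ge>M. norm (p m A - p n A) < e" by blast
  qed
  then have "\<exists>l. (\<lambda>n. p n A) \<longlonglongrightarrow> l" if "A \<in> sets borel" for A
    using that by (simp add: Cauchy_convergent_iff convergent_def)
  then obtain m where m: "(\<lambda>n. p n A) \<longlonglongrightarrow> m A" if "A \<in> sets borel" for A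
    by metis
  have m_nonneg: "0 \<le> m A" if "A \<in> sets borel" for A
    by (rule LIMSEQ_le_const[OF m[OF that]]) (simp add: p_def)
  have m_close: "\<bar>m A - p n A\<bar> \<le> \<kappa> ^ n" if A: "A \<in> sets borel" for A n
  proof (rule LIMSEQ_le_const2)
    show "(\<lambda>k. \<bar>p (k + n) A - p n A\<bar>) \<longlonglongrightarrow> \<bar>m A - p n A\<bar>"
      using LIMSEQ_ignore_initial_segment[OF m[OF A], of n] by (intro tendsto_intros)
    show "\<exists>N. \<forall>k\<ge>N. \<bar>p (k + n) A - p n A\<bar> \<le> \<kappa> ^ n" using close[OF A] by blast
  qed
  define \<pi> where "\<pi> = measure_of UNIV (sets borel) (\<lambda>A. ennreal (m A))"
  have sets: "sets \<pi> = sets borel"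
    unfolding \<pi>_def by (metis sets.sets_measure_of_eq space_borel)
  have SA: "sigma_algebra UNIV (sets (borel :: real measure))"
    using sets.sigma_algebra_axioms[of "borel :: real measure"] by simp
  have m_Un: "m (A \<union> B) = m A + m B"
    if "A \<in> sets borel" "B \<in> sets borel" "A \<inter> B = {}" for A B
  proof (rule LIMSEQ_unique)
    show "(\<lambda>n. p n (A \<union> B)) \<longlonglongrightarrow> m (A \<union> B)" using that by (intro m) auto
    have "p n (A \<union> B) = p n A + p n B" for n
      unfolding p_def using that by (intro L.finite_measure_Union) auto
    then show "(\<lambda>n. p n (A \<union> B)) \<longlonglongrightarrow> m A + m B"
      using that by (auto intro!: tendsto_add m)
  qed
  have m_empty: "m {} = 0" using m_Un[of "{}" "{}"] by simp
  have "countably_additive (sets (borel :: real measure)) (\<lambda>A. ennreal (m A))"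
  proof (rule ring_of_sets.empty_continuous_imp_countably_additive)
    show "ring_of_sets UNIV (sets (borel :: real measure))"
      using sets.ring_of_sets_axioms[of "borel :: real measure"] by simp
    show "positive (sets borel) (\<lambda>A. ennreal (m A))" by (simp add: positive_def m_empty)
    show "additive (sets borel) (\<lambda>A. ennreal (m A))"
      by (auto simp: additive_def m_Un m_nonneg)
    show "\<forall>A\<in>sets borel. ennreal (m A) \<noteq> \<infinity>" by simp
    fix A :: "nat \<Rightarrow> real set"
    assume A: "range A \<subseteq> sets borel" "decseq A" "\<Inter> (range A) = {}"
    \<comment> \<open>Since closeness is uniform over Borel sets, one fixed \<open>n\<close> serves
      all \<open>A i\<close>, and continuity from above of the law at time \<open>n\<close>
      finishes.\<close>
    have "(\<lambda>i. m (A i)) \<longlonglongrightarrow> 0"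
    proof (rule LIMSEQ_I)
      fix e :: real assume "0 < e"
      then have "\<forall>\<^sub>F n in sequentially. \<kappa> ^ n < e / 2"
        using order_tendstoD(2)[OF \<kappa>_lim, of "e / 2"] by simp
      then obtain n where n: "\<kappa> ^ n < e / 2" by (auto simp: eventually_sequentially)
      have "(\<lambda>i. p n (A i)) \<longlonglongrightarrow> p n (\<Inter> (range A))"
        unfolding p_def using A by (intro L.finite_Lim_measure_decseq) auto
      then have "\<forall>\<^sub>F i in sequentially. p n (A i) < e / 2"
        using \<open>0 < e\<close> A(3) by (intro order_tendstoD(2)) (auto simp: p_def)
      then have "\<forall>\<^sub>F i in sequentially. norm (m (A i) - 0) < e"
      proof eventually_elim
        case (elim i)
        have "A i \<in> sets borel" using A by auto
        then show ?case using elim n m_close[of "A i" n] m_nonneg[of "A i"] by auto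
      qed
      then show "\<exists>no. \<forall>i\<ge>no. norm (m (A i) - 0) < e" by (simp add: eventually_sequentially)
    qed
    then show "(\<lambda>i. ennreal (m (A i))) \<longlonglongrightarrow> 0"
      by (metis tendsto_ennrealI ennreal_0)
  qed
  then have emeasure: "emeasure \<pi> A = ennreal (m A)" if "A \<in> sets borel" for A
    unfolding \<pi>_def using that SA
    by (intro emeasure_measure_of_sigma) (auto simp: positive_def m_empty)
  have "m UNIV = 1"
  proof (rule LIMSEQ_unique[OF m])
    have "p n UNIV = 1" for n
      using L.prob_space[of n] sets_eq_imp_space_eq[OF sets_law, of 0 "real n"] by (simp add: p_def)
    then show "(\<lambda>n. p n UNIV) \<longlonglongrightarrow> 1" by simp
  qed simp
  then have "prob_space \<pi>"
    using emeasure[of UNIV] sets_eq_imp_space_eq[OF sets] by (intro prob_spaceI) simp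
  moreover have "measure \<pi> A = m A" if "A \<in> sets borel" for A
    using that by (simp add: measure_def emeasure m_nonneg)
  ultimately show ?thesis
    using m_close sets by (intro that[of \<pi>]) (auto simp: p_def)
qed

text \<open>Three replacements, each costing \<open>\<kappa> ^ n\<close>: \<pi> by the law at time
  \<open>n\<close> from 0, then the law at time \<open>t + n\<close> by the one at time
  \<open>n\<close>, then that law by \<pi> again. The total \<open>3 * \<kappa> ^ n\<close>
  vanishes.\<close>

lemma ex_is_invariant: "\<exists>\<pi>. is_invariant G lam \<pi>"
proof -
  obtain \<pi> where sets: "sets \<pi> = sets borel" and "prob_space \<pi>" and
    close: "\<And>A n. A \<in> sets borel \<Longrightarrow>
      \<bar>measure \<pi> A - measure (workload_law G lam 0 (real n)) A\<bar> \<le> \<kappa> ^ n"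
    by (rule uniform_limit_law) blast
  interpret \<pi>: prob_space \<pi> by fact
  let ?\<mu> = "\<lambda>n. workload_law G lam 0 (real n)"
  interpret L: prob_space "?\<mu> n" for n by (rule prob_space_law)
  have le: "emeasure \<pi> A \<le> emeasure (?\<mu> n) A + ennreal (\<kappa> ^ n)"
      "emeasure (?\<mu> n) A \<le> emeasure \<pi> A + ennreal (\<kappa> ^ n)" if "A \<in> sets borel" for A n
    unfolding \<pi>.emeasure_eq_measure L.emeasure_eq_measure
    using close[OF that, of n] \<kappa>
    by (simp_all add: ennreal_plus[symmetric] abs_le_iff del: ennreal_plus)
  have three: "x + ennreal (\<kappa> ^ n) + ennreal (\<kappa> ^ n) + ennreal (\<kappa> ^ n) = x + ennreal (3 * \<kappa> ^ n)" for x n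
    using \<kappa> by (simp add: add.assoc ennreal_plus[symmetric] del: ennreal_plus)
  have "is_invariant G lam \<pi>"
    unfolding is_invariant_def
  proof (intro conjI allI impI ballI)
    have "1 \<le> emeasure \<pi> {0..1}"
    proof (rule ennreal_le_if_le_add_power[where C=1, OF \<kappa>])
      fix n
      have "emeasure (?\<mu> n) {0..1} = 1"
        using AE_law[of 0 "real n"] by (intro L.emeasure_eq_1_AE) auto
      then show "1 \<le> emeasure \<pi> {0..1} + ennreal (1 * \<kappa> ^ n)"
        using le(2)[of "{0..1}" n] by simp
    qed
    then show "emeasure \<pi> {0..1} = 1"
      using \<pi>.emeasure_le_1[of "{0..1}"] by (rule antisym[rotated])
    fix t :: real and A :: "real set" assume t: "0 \<le> t" and A [measurable]: "A \<in> sets borel"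
    let ?g = "P t (indicator A)"
    have [measurable]: "?g \<in> borel_measurable borel" by measurable
    have g1: "?g x \<le> 1" for x by (rule P_le_1) (simp split: split_indicator)
    have \<mu>_g: "(\<integral>\<^sup>+x. ?g x \<partial>?\<mu> n) = P (t + real n) (indicator A) 0" for n
      using t by (simp add: nn_integral_law add.commute[of t] Chapman_Kolmogorov split: split_indicator)
    have approx: "P (t + real n) (indicator A) 0 \<le> emeasure (?\<mu> n) A + ennreal (\<kappa> ^ n)"
      "emeasure (?\<mu> n) A \<le> P (t + real n) (indicator A) 0 + ennreal (\<kappa> ^ n)" for n
      using P_approx[of "indicator A" 0 0 t n] t by (simp_all add: emeasure_law split: split_indicator)
    have "(\<integral>\<^sup>+x. ?g x \<partial>\<pi>) = emeasure \<pi> A"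
    proof (rule antisym)
      show "(\<integral>\<^sup>+x. ?g x \<partial>\<pi>) \<le> emeasure \<pi> A"
      proof (rule ennreal_le_if_le_add_power[where C=3, OF \<kappa>])
        fix n
        have "(\<integral>\<^sup>+x. ?g x \<partial>\<pi>) \<le> (\<integral>\<^sup>+x. ?g x \<partial>?\<mu> n) + ennreal (\<kappa> ^ n)"
          by (rule nn_integral_le_if_emeasure_le)
            (auto intro: le g1 prob_space_law \<open>prob_space \<pi>\<close> simp: sets)
        also have "\<dots> \<le> emeasure (?\<mu> n) A + ennreal (\<kappa> ^ n) + ennreal (\<kappa> ^ n)"
          unfolding \<mu>_g by (intro add_right_mono approx)
        also have "\<dots> \<le> emeasure \<pi> A + ennreal (\<kappa> ^ n) + ennreal (\<kappa> ^ n) + ennreal (\<kappa> ^ n)"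
          by (intro add_right_mono le A)
        finally show "(\<integral>\<^sup>+x. ?g x \<partial>\<pi>) \<le> emeasure \<pi> A + ennreal (3 * \<kappa> ^ n)"
          unfolding three .
      qed
      show "emeasure \<pi> A \<le> (\<integral>\<^sup>+x. ?g x \<partial>\<pi>)"
      proof (rule ennreal_le_if_le_add_power[where C=3, OF \<kappa>])
        fix n
        have "emeasure \<pi> A \<le> emeasure (?\<mu> n) A + ennreal (\<kappa> ^ n)"
          by (rule le[OF A])
        also have "\<dots> \<le> (\<integral>\<^sup>+x. ?g x \<partial>?\<mu> n) + ennreal (\<kappa> ^ n) + ennreal (\<kappa> ^ n)"
          unfolding \<mu>_g by (intro add_right_mono approx)
        also have "(\<integral>\<^sup>+x. ?g x \<partial>?\<mu> n) \<le> (\<integral>\<^sup>+x. ?g x \<partial>\<pi>) + ennreal (\<kappa> ^ n)"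
          by (rule nn_integral_le_if_emeasure_le)
            (auto intro: le g1 prob_space_law \<open>prob_space \<pi>\<close> simp: sets)
        finally show "emeasure \<pi> A \<le> (\<integral>\<^sup>+x. ?g x \<partial>\<pi>) + ennreal (3 * \<kappa> ^ n)"
          unfolding three[symmetric] by (simp add: add_right_mono)
      qed
    qed
    then show "(\<integral>\<^sup>+x. emeasure (workload_law G lam x t) A \<partial>\<pi>) = emeasure \<pi> A"
      by (simp add: emeasure_law)
  qed (use sets \<open>prob_space \<pi>\<close> in auto)
  then show ?thesis ..
qed

lemma prob_space_invariant_law: "prob_space (invariant_law G lam)"
proof -
  obtain \<pi> where \<pi>: "is_invariant G lam \<pi>" using ex_is_invariant ..
  have "is_invariant G lam (invariant_law G lam)"
    unfolding invariant_law_def using \<pi> is_invariant_unique[OF _ \<pi>] by (rule theI)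
  then show ?thesis by (simp add: is_invariant_def)
qed

section \<open>Distance to equilibrium\<close>

lemma mixing_dist_bounds:
  assumes "x \<in> {0..1}"
  shows "tv_dist (workload_law G lam x t) (invariant_law G lam) \<le> mixing_dist G lam t"
    and "mixing_dist G lam t \<le> 1" and "0 \<le> mixing_dist G lam t"
proof -
  let ?tv = "\<lambda>x. tv_dist (workload_law G lam x t) (invariant_law G lam)"
  have tv: "0 \<le> ?tv x" "?tv x \<le> 1" for x
    using tv_dist_nonneg tv_dist_le_1 prob_space_law prob_space_invariant_law by blast+
  \<comment> \<open>A real \<open>SUP\<close> is an upper bound only for bounded families; total
    variation at most 1 provides this.\<close>
  then have "bdd_above (?tv ` {0..1})" by (intro bdd_aboveI2) auto
  then show "?tv x \<le> mixing_dist G lam t"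
    unfolding mixing_dist_def using assms by (rule cSUP_upper2[OF _ _ order_refl])
  with tv(1)[of x] show "0 \<le> mixing_dist G lam t" by simp
  show "mixing_dist G lam t \<le> 1"
    unfolding mixing_dist_def using tv by (intro cSUP_least) auto
qed

lemma spectral_gap_nonneg: "0 \<le> spectral_gap G lam"
proof -
  have "conv_rate G lam \<le> 1"
    unfolding conv_rate_def
  proof (rule Limsup_bounded)
    show "\<forall>\<^sub>F t in at_top. ereal (mixing_dist G lam t powr (1 / t)) \<le> 1"
      using eventually_ge_at_top[of 0]
    proof eventually_elim
      case (elim t)
      then have "mixing_dist G lam t powr (1 / t) \<le> 1 powr (1 / t)"
        using mixing_dist_bounds[of 0 t] by (intro powr_mono2) auto
      then show ?case by simp
    qed
  qed
  then show ?thesis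
    unfolding spectral_gap_def by (cases "conv_rate G lam") (auto simp: one_ereal_def)
qed

text \<open>Triangle inequality through the invariant law: \<open>mixing_dist\<close> can be bounded
  below without computing that law.\<close>

lemma measure_law_diff_le_mixing_dist:
  assumes "x \<in> {0..1}" "y \<in> {0..1}" "A \<in> sets borel"
  shows "measure (workload_law G lam x t) A - measure (workload_law G lam y t) A
    \<le> 2 * mixing_dist G lam t"
  using mixing_dist_bounds(1)[OF assms(1), of t] mixing_dist_bounds(1)[OF assms(2), of t]
    abs_measure_diff_le_tv_dist[OF prob_space_law prob_space_invariant_law assms(3), of x t]
    abs_measure_diff_le_tv_dist[OF prob_space_law prob_space_invariant_law assms(3), of y t]
  by linarith

end

section \<open>Slow mixing\<close>

text \<open>The arrival rate \<open>mu + \<gamma>\<close> is chosen so that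
  \<open>exp (- \<gamma> t) sin (\<theta> x)\<close> satisfies the renewal equation of the lower copy killed outside \<open>[0, 1/2]\<close>
  up to boundary terms of the favourable sign.\<close>

locale balanced_queue =
  fixes mu :: real
  assumes mu: "0 < mu"
begin

section \<open>Sine subsolution of the renewal equation\<close>

abbreviation \<theta> :: real where "\<theta> \<equiv> 2 * pi"

text \<open>\<open>sin (\<theta> * x)\<close> vanishes at both ends of \<open>[0, 1/2]\<close>. This
  \<gamma> is the decay rate for which \<open>(mu + \<gamma>) * mu\<close> equals mu^2 + \<theta>^2,
  the denominator in \<open>g\<close>.\<close>

definition \<gamma> :: real where "\<gamma> = \<theta>\<^sup>2 / mu"

lemma \<gamma>_pos: "0 < \<gamma>"
  using mu by (simp add: \<gamma>_def)

sublocale truncated_queue "exp_law mu" "mu + \<gamma>"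
  using mu \<gamma>_pos by unfold_locales (auto intro: exp_law_service_law)

text \<open>The mean of \<open>sin (\<theta> * (y + B))\<close> for a service time \<open>B\<close>
  that is exponential with rate \<open>mu\<close>.\<close>

definition g :: "real \<Rightarrow> real" where
  "g y = mu * (mu * sin (\<theta> * y) + \<theta> * cos (\<theta> * y)) / (mu\<^sup>2 + \<theta>\<^sup>2)"

lemma measurable_g [measurable]: "g \<in> borel_measurable borel"
  unfolding g_def by measurable

lemma denominator_pos: "0 < mu\<^sup>2 + \<theta>\<^sup>2"
  using mu by (simp add: add_pos_nonneg)

lemma service_step:
  assumes "0 \<le> y" "y \<le> 1 / 2"
  shows "ennreal (g y) \<le>
    (\<integral>\<^sup>+b. ennreal (sin (\<theta> * (y + b))) * indicator {..1 / 2 - y} b \<partial>exp_law mu)"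
proof -
  let ?d = "mu\<^sup>2 + \<theta>\<^sup>2"
  let ?F = "\<lambda>b. - (mu * exp (- mu * b) * (mu * sin (\<theta> * (y + b)) + \<theta> * cos (\<theta> * (y + b)))) / ?d"
  let ?f = "\<lambda>b. mu * exp (- mu * b) * sin (\<theta> * (y + b))"
  \<comment> \<open>At the upper limit the sine is 0 and the cosine -1, so the boundary term is
    positive: stopping where \<open>y + b\<close> reaches 1/2 only increases the integral.\<close>
  have "\<theta> * (y + (1 / 2 - y)) = pi" by simp
  then have "?F (1 / 2 - y) = mu * exp (- mu * (1 / 2 - y)) * \<theta> / ?d" by simp
  moreover have "0 \<le> mu * exp (- mu * (1 / 2 - y)) * \<theta> / ?d"
    using mu by simp
  moreover have "?F 0 = - g y" by (simp add: g_def)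
  ultimately have "g y \<le> ?F (1 / 2 - y) - ?F 0" by linarith
  then have "ennreal (g y) \<le> ennreal (?F (1 / 2 - y) - ?F 0)"
    by (rule ennreal_leI)
  also have "\<dots> \<le> (\<integral>\<^sup>+b. ennreal (?f b) * indicator {0..1 / 2 - y} b \<partial>lborel)"
  proof (rule FTC_le_nn_integral)
    fix b :: real
    have F: "?F = (\<lambda>b. mu / ?d * - (exp (- mu * b) * (mu * sin (\<theta> * (y + b)) + \<theta> * cos (\<theta> * (y + b)))))"
      by (simp add: fun_eq_iff mult.assoc)
    have f: "?f b = mu / ?d * (exp (- mu * b) * sin (\<theta> * (y + b)) * ?d)"
      using denominator_pos by (simp add: mult.assoc)
    show "(?F has_real_derivative ?f b) (at b)"
      unfolding F f by (rule DERIV_cmult[OF DERIV_exp_sin_cos])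
  qed (use assms in \<open>auto intro!: continuous_intros\<close>)
  also have "\<dots> \<le> (\<integral>\<^sup>+b. ennreal (exponential_density mu b) *
      (ennreal (sin (\<theta> * (y + b))) * indicator {..1 / 2 - y} b) \<partial>lborel)"
  proof (rule nn_integral_mono)
    fix b :: real
    show "ennreal (?f b) * indicator {0..1 / 2 - y} b \<le> ennreal (exponential_density mu b) *
      (ennreal (sin (\<theta> * (y + b))) * indicator {..1 / 2 - y} b)"
      using mu by (auto simp: exponential_density_def ennreal_mult'[symmetric] mult.commute[of b]
          split: split_indicator)
  qed
  also have "\<dots> = (\<integral>\<^sup>+b. ennreal (sin (\<theta> * (y + b))) * indicator {..1 / 2 - y} b \<partial>exp_law mu)"
    by (rule nn_integral_exp_law[symmetric]) measurable
  finally show ?thesis .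
qed

text \<open>The damping \<open>exp (- \<gamma> * (t - a))\<close> offsets the excess \<gamma> of the
  arrival rate over \<open>mu\<close>, which leaves
  \<open>exp (- \<gamma> * t) * exp (- mu * a)\<close> and makes the integrand an exact
  derivative.\<close>

lemma arrival_step:
  assumes "0 \<le> m"
  shows "ennreal (exp (- \<gamma> * t) * (sin (\<theta> * x) - exp (- mu * m) * sin (\<theta> * (x - m)))) \<le>
    (\<integral>\<^sup>+a. ennreal (exp (- \<gamma> * (t - a)) * g (x - a)) * indicator {0..m} a \<partial>E)"
proof -
  let ?F = "\<lambda>a. - (exp (- \<gamma> * t) * exp (- mu * a) * sin (\<theta> * (x - a)))"
  let ?f = "\<lambda>a. exp (- \<gamma> * t) * exp (- mu * a) * (mu * sin (\<theta> * (x - a)) + \<theta> * cos (\<theta> * (x - a)))"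
  have F: "exp (- \<gamma> * t) * (sin (\<theta> * x) - exp (- mu * m) * sin (\<theta> * (x - m))) = ?F m - ?F 0"
    by (simp add: algebra_simps)
  have "ennreal (?F m - ?F 0) \<le> (\<integral>\<^sup>+a. ennreal (?f a) * indicator {0..m} a \<partial>lborel)"
  proof (rule FTC_le_nn_integral)
    show "(?F has_real_derivative ?f a) (at a)" for a
      using DERIV_cmult[OF DERIV_exp_sin, of "exp (- \<gamma> * t)" mu \<theta> x a] by (simp add: mult.assoc)
  qed (use assms in \<open>auto intro!: continuous_intros\<close>)
  also have "\<dots> = (\<integral>\<^sup>+a. ennreal (exponential_density (mu + \<gamma>) a) *
      (ennreal (exp (- \<gamma> * (t - a)) * g (x - a)) * indicator {0..m} a) \<partial>lborel)"
  proof (rule nn_integral_cong)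
    fix a :: real
    have "(mu + \<gamma>) * mu = mu\<^sup>2 + \<theta>\<^sup>2"
      using mu by (simp add: \<gamma>_def distrib_right power2_eq_square)
    then have rate: "(mu + \<gamma>) * mu / (mu\<^sup>2 + \<theta>\<^sup>2) = 1"
      using denominator_pos by simp
    have exp: "exp (- a * (mu + \<gamma>)) * exp (- \<gamma> * (t - a)) = exp (- \<gamma> * t) * exp (- mu * a)"
      unfolding exp_add[symmetric] by (simp add: algebra_simps)
    have "(mu + \<gamma>) * exp (- a * (mu + \<gamma>)) * (exp (- \<gamma> * (t - a)) * g (x - a)) =
        (mu + \<gamma>) * mu / (mu\<^sup>2 + \<theta>\<^sup>2) * (exp (- a * (mu + \<gamma>)) * exp (- \<gamma> * (t - a))) *
          (mu * sin (\<theta> * (x - a)) + \<theta> * cos (\<theta> * (x - a)))"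
      unfolding g_def by (simp only: times_divide_eq_right times_divide_eq_left mult_ac)
    also have "\<dots> = ?f a"
      unfolding rate exp by simp
    finally have "?f a = (mu + \<gamma>) * exp (- a * (mu + \<gamma>)) * (exp (- \<gamma> * (t - a)) * g (x - a))" ..
    then show "ennreal (?f a) * indicator {0..m} a = ennreal (exponential_density (mu + \<gamma>) a) *
      (ennreal (exp (- \<gamma> * (t - a)) * g (x - a)) * indicator {0..m} a)"
      using mu \<gamma>_pos
      by (auto simp: exponential_density_def ennreal_mult'[symmetric] split: split_indicator)
  qed
  also have "\<dots> = (\<integral>\<^sup>+a. ennreal (exp (- \<gamma> * (t - a)) * g (x - a)) * indicator {0..m} a \<partial>E)"
    by (rule nn_integral_exp_law[symmetric]) measurable
  finally show ?thesis unfolding F .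
qed

lemma sin_subsolution:
  assumes "0 \<le> t" "0 \<le> x"
  shows "ennreal (exp (- \<gamma> * t) * sin (\<theta> * x)) \<le>
    (\<integral>\<^sup>+a. (if t < a then if t \<le> x then 1 else 0
      else ennreal (exp (- \<gamma> * (t - a)) * g (x - a)) * indicator {0..min t x} a) \<partial>E)"
    (is "_ \<le> ?R")
proof -
  let ?Y = "\<lambda>a. ennreal (exp (- \<gamma> * (t - a)) * g (x - a)) * indicator {0..min t x} a"
  \<comment> \<open>Integration stops at \<open>min t x\<close>. If \<open>t \<le> x\<close>, the
    boundary term left over is at most the probability \<open>?A\<close> of no arrival, because the
    sine is at most 1; if \<open>x < t\<close>, it contains \<open>sin 0 = 0\<close>.\<close>
  let ?A = "if t \<le> x then exp (- (mu + \<gamma>) * t) else 0"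
  let ?B = "exp (- \<gamma> * t) * (sin (\<theta> * x) - exp (- mu * min t x) * sin (\<theta> * (x - min t x)))"
  have "exp (- \<gamma> * t) * sin (\<theta> * x) \<le> ?A + ?B"
  proof (cases "t \<le> x")
    case True
    have "exp (- \<gamma> * t) * exp (- mu * t) = exp (- (mu + \<gamma>) * t)"
      unfolding exp_add[symmetric] by (simp add: algebra_simps)
    then have "exp (- \<gamma> * t) * (exp (- mu * t) * sin (\<theta> * (x - t))) =
        exp (- (mu + \<gamma>) * t) * sin (\<theta> * (x - t))"
      by (simp only: mult.assoc[symmetric])
    also have "\<dots> \<le> exp (- (mu + \<gamma>) * t) * 1"
      by (intro mult_left_mono) auto
    finally show ?thesis using True by (simp add: right_diff_distrib)
  qed simp
  then have "ennreal (exp (- \<gamma> * t) * sin (\<theta> * x)) \<le> ennreal (?A + ?B)"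
    by (rule ennreal_leI)
  also have "\<dots> \<le> ennreal ?A + ennreal ?B"
    by (rule ennreal_add_le) simp
  also have "ennreal ?B \<le> (\<integral>\<^sup>+a. ?Y a \<partial>E)"
    using assms by (intro arrival_step) simp
  also have "\<dots> = (\<integral>\<^sup>+a. ?Y a * indicator {..t} a \<partial>E)"
    by (intro nn_integral_cong) (auto split: split_indicator)
  also have "ennreal ?A = (\<integral>\<^sup>+a. (if t \<le> x then 1 else 0) * indicator {t<..} a \<partial>E)"
    using memoryless[of "\<lambda>a. if t \<le> x then 1 else 0" t] \<open>0 \<le> t\<close>
    by (simp add: E.emeasure_space_1[simplified])
  also have "(\<integral>\<^sup>+a. (if t \<le> x then 1 else 0) * indicator {t<..} a \<partial>E) +
      (\<integral>\<^sup>+a. ?Y a * indicator {..t} a \<partial>E) = ?R"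
    by (rule split_first_arrival[symmetric]) measurable
  finally show ?thesis by (simp add: add_left_mono)
qed

section \<open>Two copies kept at distance 1/2\<close>

abbreviation separated :: "real \<times> real \<Rightarrow> ennreal" where
  "separated \<equiv> indicator {p. fst p < 1 / 2 \<and> 1 / 2 \<le> snd p}"

text \<open>Iteration of the renewal equation that counts only moves preserving the distance:
  \<open>a \<le> x\<close>, so the lower copy has not idled, and
  \<open>b \<le> 1 / 2 - (x - a)\<close>, so the upper copy is not truncated. Other moves are
  bounded below by 0.\<close>

lemma separation_lower_bound:
  assumes "0 \<le> t" "x \<in> {0..1 / 2}"
  shows "ennreal (exp (- \<gamma> * t) * sin (\<theta> * x)) \<le> two_point t separated x (x + 1 / 2)"
proof -
  define t0 where "t0 = t"
  have t0: "0 \<le> t0" using \<open>0 \<le> t\<close> by (simp add: t0_def)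
  define c where "c = 1 - exp (- (mu + \<gamma>) * t0)"
  have c: "0 \<le> c" "c < 1" using mult_nonpos_nonneg[of "- (mu + \<gamma>)", OF _ t0] lam by (auto simp: c_def)
  have [measurable]: "separated \<in> borel_measurable (borel \<Otimes>\<^sub>M borel)" by measurable
  have "ennreal (exp (- \<gamma> * t) * sin (\<theta> * x)) \<le>
      two_point t separated x (x + 1 / 2) + ennreal (c ^ n)"
    if "0 \<le> t" "t \<le> t0" "x \<in> {0..1 / 2}" for n t x
    using that
  proof (induction n arbitrary: t x)
    case 0
    have "exp (- \<gamma> * t) * sin (\<theta> * x) \<le> 1 * 1"
      using 0 \<gamma>_pos by (intro mult_mono') (auto intro: sin_ge_zero)
    then have "ennreal (exp (- \<gamma> * t) * sin (\<theta> * x)) \<le> 1"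
      by simp
    then show ?case by (simp add: add_increasing)
  next
    case (Suc n)
    show ?case
    \<comment> \<open>At \<open>x = 1 / 2\<close> the lower copy is not below 1/2, so separation
      fails at time 0; the sine vanishes there.\<close>
    proof (cases "x = 1 / 2")
      case True
      have "sin (\<theta> * x) = 0" by (subst True) simp
      then show ?thesis by simp
    next
      case False
      then have x: "0 \<le> x" "x < 1 / 2" using Suc.prems by auto
      let ?K = "\<lambda>a. if t < a then if t \<le> x then 1 else 0
        else ennreal (exp (- \<gamma> * (t - a)) * g (x - a)) * indicator {0..min t x} a"
      let ?R = "\<lambda>a. if t < a then separated (max (x - t) 0, max (x + 1 / 2 - t) 0)
        else \<integral>\<^sup>+b. two_point (t - a) separated (jump a b x) (jump a b (x + 1 / 2)) \<partial>exp_law mu"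
      have "ennreal (exp (- \<gamma> * t) * sin (\<theta> * x)) \<le> (\<integral>\<^sup>+a. ?K a \<partial>E)"
        using Suc.prems x by (intro sin_subsolution) auto
      also have "\<dots> \<le> (\<integral>\<^sup>+a. ?R a + ennreal (c ^ n) * indicator {..t0} a \<partial>E)"
      proof (intro nn_integral_mono_AE eventually_mono[OF AE_exp_law_pos])
        fix a :: real assume a: "0 < a"
        show "?K a \<le> ?R a + ennreal (c ^ n) * indicator {..t0} a"
        proof (cases "t < a")
          case True
          \<comment> \<open>Without an arrival and with \<open>t \<le> x\<close> both copies drain
            equally. The closed end in \<open>separated\<close> covers \<open>t = x\<close>, where
            the upper copy sits exactly at 1/2.\<close>
          then show ?thesis using x Suc.prems by (auto simp: add_increasing2)
        next
          case False
          show ?thesis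
          proof (cases "a \<le> x")
            case True
            let ?y = "x - a"
            have "ennreal (exp (- \<gamma> * (t - a)) * g ?y) = ennreal (exp (- \<gamma> * (t - a))) * ennreal (g ?y)"
              by (rule ennreal_mult') simp
            also have "\<dots> \<le> ennreal (exp (- \<gamma> * (t - a))) *
                (\<integral>\<^sup>+b. ennreal (sin (\<theta> * (?y + b))) * indicator {..1 / 2 - ?y} b \<partial>exp_law mu)"
              using True a x by (intro mult_left_mono service_step) auto
            also have "\<dots> = (\<integral>\<^sup>+b. ennreal (exp (- \<gamma> * (t - a))) *
                (ennreal (sin (\<theta> * (?y + b))) * indicator {..1 / 2 - ?y} b) \<partial>exp_law mu)"
              by (rule nn_integral_cmult[symmetric]) measurable
            also have "\<dots> \<le> (\<integral>\<^sup>+b. two_point (t - a) separated (jump a b x) (jump a b (x + 1 / 2)) +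
                ennreal (c ^ n) \<partial>exp_law mu)"
            proof (intro nn_integral_mono_AE eventually_mono[OF AE_exp_law_pos])
              fix b :: real assume b: "0 < b"
              show "ennreal (exp (- \<gamma> * (t - a))) *
                  (ennreal (sin (\<theta> * (?y + b))) * indicator {..1 / 2 - ?y} b) \<le>
                two_point (t - a) separated (jump a b x) (jump a b (x + 1 / 2)) + ennreal (c ^ n)"
              proof (cases "b \<le> 1 / 2 - ?y")
                case b': True
                have J: "jump a b x = ?y + b" "jump a b (x + 1 / 2) = (?y + b) + 1 / 2"
                  using b' b True by auto
                have "?y + b \<in> {0..1 / 2}" using b b' True by auto
                then show ?thesis
                  unfolding J using Suc.IH[of "t - a" "?y + b"] False a Suc.prems b'
                  by (simp add: ennreal_mult'[symmetric])
              qed simp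
            qed
            also have "\<dots> = (\<integral>\<^sup>+b. two_point (t - a) separated (jump a b x) (jump a b (x + 1 / 2)) \<partial>exp_law mu) +
                ennreal (c ^ n)"
              by (subst nn_integral_add) (auto simp: G.emeasure_space_1[simplified])
            finally show ?thesis using False True a Suc.prems by simp
          qed (use False in simp)
        qed
      qed
      also have "\<dots> = two_point t separated x (x + 1 / 2) + ennreal (c ^ n) * ennreal c"
        unfolding two_point_renewal[OF \<open>separated \<in> borel_measurable (borel \<Otimes>\<^sub>M borel)\<close>, of t]
          c_def nn_integral_E_atMost[OF t0, symmetric]
        by (subst nn_integral_add) (auto simp: nn_integral_cmult)
      also have "ennreal (c ^ n) * ennreal c = ennreal (c ^ Suc n)"
        using c by (simp add: ennreal_mult'[symmetric] mult.commute)
      finally show ?thesis .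
    qed
  qed
  then have le: "ennreal (exp (- \<gamma> * t) * sin (\<theta> * x)) \<le>
      two_point t separated x (x + 1 / 2) + ennreal (c ^ n)" for n
    using assms by (simp add: t0_def)
  show ?thesis
    by (rule ennreal_le_if_le_add_power[where C=1, OF c]) (use le in simp)
qed

lemma mixing_dist_ge:
  assumes "0 \<le> t"
  shows "exp (- \<gamma> * t) / 2 \<le> mixing_dist (exp_law mu) (mu + \<gamma>) t"
proof -
  let ?law = "\<lambda>x. workload_law (exp_law mu) (mu + \<gamma>) x t"
  interpret L: prob_space "?law x" for x by (rule prob_space_law)
  let ?B = "indicator {1 / 2..} :: real \<Rightarrow> ennreal"
  have [measurable]: "separated \<in> borel_measurable (borel \<Otimes>\<^sub>M borel)" by measurable
  \<comment> \<open>The start \<open>1 / 4\<close> maximises the sine. Adding the event that the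
    lower copy is at least 1/2 gives, by monotonicity, at most the event that the upper copy
    is.\<close>
  have "ennreal (exp (- \<gamma> * t)) + P t ?B (1 / 4) \<le> two_point t separated (1 / 4) (3 / 4) + P t ?B (1 / 4)"
    using separation_lower_bound[of t "1 / 4"] assms by (simp add: add_right_mono)
  also have "\<dots> = (\<integral>\<^sup>+w. separated (workload (1 / 4) (fst w) (snd w) t, workload (3 / 4) (fst w) (snd w) t) +
      ?B (workload (1 / 4) (fst w) (snd w) t) \<partial>I)"
    unfolding two_point_def P_def by (subst nn_integral_add) auto
  also have "\<dots> \<le> P t ?B (3 / 4)"
    unfolding P_def
  proof (rule nn_integral_mono)
    fix w :: "(nat \<Rightarrow> real) \<times> (nat \<Rightarrow> real)"
    have "workload (1 / 4) (fst w) (snd w) t \<le> workload (3 / 4) (fst w) (snd w) t"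
      by (rule workload_mono) simp
    then show "separated (workload (1 / 4) (fst w) (snd w) t, workload (3 / 4) (fst w) (snd w) t) +
      ?B (workload (1 / 4) (fst w) (snd w) t) \<le> ?B (workload (3 / 4) (fst w) (snd w) t)"
      by (auto split: split_indicator)
  qed
  finally have "ennreal (exp (- \<gamma> * t)) + ennreal (measure (?law (1 / 4)) {1 / 2..}) \<le>
      ennreal (measure (?law (3 / 4)) {1 / 2..})"
    by (simp add: emeasure_law[symmetric] L.emeasure_eq_measure)
  then have "exp (- \<gamma> * t) + measure (?law (1 / 4)) {1 / 2..} \<le> measure (?law (3 / 4)) {1 / 2..}"
    by (simp add: ennreal_plus[symmetric] del: ennreal_plus)
  then show ?thesis
    using measure_law_diff_le_mixing_dist[of "3 / 4" "1 / 4" "{1 / 2..}" t] by simp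
qed

text \<open>Taking \<open>t\<close>-th roots turns the factor 1/2 into
  \<open>exp (- ln 2 / t)\<close>, which tends to 1; then
  \<open>1 - exp (- \<gamma>) \<le> \<gamma>\<close>.\<close>

lemma spectral_gap_le: "spectral_gap (exp_law mu) (mu + \<gamma>) \<le> ereal \<gamma>"
proof -
  have "((\<lambda>t. exp (- \<gamma> - ln 2 / t)) \<longlongrightarrow> exp (- \<gamma> - 0)) at_top"
    by (intro tendsto_intros tendsto_divide_0[OF tendsto_const]
        filterlim_at_top_imp_at_infinity filterlim_ident)
  then have "Limsup at_top (\<lambda>t. ereal (exp (- \<gamma> - ln 2 / t))) = ereal (exp (- \<gamma>))"
    by (intro lim_imp_Limsup) auto
  then have "ereal (exp (- \<gamma>)) = Limsup at_top (\<lambda>t. ereal (exp (- \<gamma> - ln 2 / t)))" ..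
  also have "\<dots> \<le> conv_rate (exp_law mu) (mu + \<gamma>)"
    unfolding conv_rate_def
  proof (rule Limsup_mono)
    show "\<forall>\<^sub>F t in at_top. ereal (exp (- \<gamma> - ln 2 / t)) \<le>
        ereal (mixing_dist (exp_law mu) (mu + \<gamma>) t powr (1 / t))"
      using eventually_gt_at_top[of 0]
    proof eventually_elim
      case (elim t)
      have "exp (- \<gamma> - ln 2 / t) = (exp (- \<gamma> * t) / 2) powr (1 / t)"
        using elim by (simp add: powr_def ln_div field_simps)
      also have "\<dots> \<le> mixing_dist (exp_law mu) (mu + \<gamma>) t powr (1 / t)"
        using elim mixing_dist_ge[of t] by (intro powr_mono2) auto
      finally show ?case by simp
    qed
  qed
  finally have "spectral_gap (exp_law mu) (mu + \<gamma>) \<le> 1 - ereal (exp (- \<gamma>))"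
    unfolding spectral_gap_def by (intro ereal_minus_mono) auto
  also have "\<dots> \<le> ereal \<gamma>"
    using exp_ge_add_one_self[of "- \<gamma>"] by (simp add: one_ereal_def)
  finally show ?thesis .
qed

end

theorem theorem3:
  "(INF (G, lam) \<in> service_laws \<times> {0<..}. spectral_gap G lam) = 0"
proof (rule antisym)
  show "(INF (G, lam) \<in> service_laws \<times> {0<..}. spectral_gap G lam) \<le> 0"
  proof (rule ereal_le_epsilon2)
    fix e :: real assume "0 < e"
    \<comment> \<open>This value of \<open>mu\<close> makes the decay rate \<gamma> equal to
      \<open>e\<close>.\<close>
    then interpret balanced_queue "(2 * pi)\<^sup>2 / e"
      by unfold_locales simp
    have "\<gamma> = e" unfolding \<gamma>_def using \<open>0 < e\<close> by simp
    have "(INF (G, lam) \<in> service_laws \<times> {0<..}. spectral_gap G lam) \<le>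
        spectral_gap (exp_law ((2 * pi)\<^sup>2 / e)) ((2 * pi)\<^sup>2 / e + \<gamma>)"
      using INF_lower[of "(exp_law ((2 * pi)\<^sup>2 / e), (2 * pi)\<^sup>2 / e + \<gamma>)" "service_laws \<times> {0<..}"
          "\<lambda>(G, lam). spectral_gap G lam"] G lam by simp
    also have "\<dots> \<le> 0 + ereal e" using spectral_gap_le \<open>\<gamma> = e\<close> by simp
    finally show "(INF (G, lam) \<in> service_laws \<times> {0<..}. spectral_gap G lam) \<le> 0 + ereal e" .
  qed
  show "0 \<le> (INF (G, lam) \<in> service_laws \<times> {0<..}. spectral_gap G lam)"
    by (auto intro!: INF_greatest truncated_queue.spectral_gap_nonneg truncated_queue.intro)
qed

end
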